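(* Let $T$ be an isotropic Gaussian random field on $\mathbb S^2$ with angular power spectrum $(A_\ell,\ell\in\mathbb N_0)$. If $\sum_{\ell=0}^\infty A_\ell\,\ell^{1+\beta}<+\infty$ for some $\beta\in(0,2]$, then there exists a continuous modification of $T$ that is Hölder continuous with exponent $\gamma$ for all $\gamma<\beta/2$.
   Context: $\mathbb S^2$ is the unit sphere in $\mathbb R^3$ with geodesic metric $d(x,y)=\arccos\langle x,y\rangle_{\mathbb R^3}$. An isotropic Gaussian random field on $\mathbb S^2$ is a jointly measurable map $T:\Omega\times\mathbb S^2\to\mathbb R$ that is Gaussian (all finite-dimensional distributions are multivariate Gaussian) with mean and covariance invariant under rotations in $\mathrm{SO}(3)$. Its angular power spectrum is the sequence of nonnegative reals $(A_\ell,\ell\in\mathbb N_0)$ with $\mathrm{Cov}(T(x),T(y))=\sum_{\ell=0}^\infty A_\ell\frac{2\ell+1}{4\pi}P_\ell(\langle x,y\rangle_{\mathbb R^3})$, where $P_\ell$ is the $\ell$-th Legendre polynomial. A modification of $T$ is a random field $\tilde T$ with $\mathbb P(\tilde T(x)=T(x))=1$ for every $x\in\mathbb S^2$; (Hölder) continuity refers to its sample paths, with respect to $d$. *)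

theory Defs
  imports "HOL-Probability.Probability" "HOL-Computational_Algebra.Polynomial"
begin

abbreviation sphere2 :: "(real^3) set"
  where "sphere2 \<equiv> sphere 0 1"

definition geodist :: "real^3 \<Rightarrow> real^3 \<Rightarrow> real"
  where "geodist x y = arccos (x \<bullet> y)"

text \<open>Rodrigues' formula: the \<open>l\<close>-th derivative of \<open>(x\<^sup>2 - 1)\<^sup>l\<close> divided by \<open>2\<^sup>l l!\<close>.\<close>

definition legendre_poly :: "nat \<Rightarrow> real poly"
  where "legendre_poly l = smult (1 / (2 ^ l * fact l)) ((pderiv ^^ l) ([:-1, 0, 1:] ^ l))"


definition random_field :: "'w measure \<Rightarrow> ('w \<Rightarrow> real^3 \<Rightarrow> real) \<Rightarrow> bool"
  where "random_field M T \<longleftrightarrow>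
    (\<lambda>(\<omega>, x). T \<omega> x) \<in> borel_measurable (M \<Otimes>\<^sub>M restrict_space borel sphere2)"

text \<open>Normal laws may be degenerate (variance zero); this is needed for Gaussian vectors
  with singular covariance, e.g. with repeated coordinates.\<close>

definition normally_distributed :: "'w measure \<Rightarrow> ('w \<Rightarrow> real) \<Rightarrow> bool"
  where "normally_distributed M X \<longleftrightarrow> X \<in> borel_measurable M \<and>
    ((\<exists>\<mu> \<sigma>. \<sigma> > 0 \<and> distributed M lborel X (normal_density \<mu> \<sigma>)) \<or>
     (\<exists>\<mu>. AE \<omega> in M. X \<omega> = \<mu>))"

text \<open>A real random vector is multivariate Gaussian iff each linear combination of its
  components is normally distributed.\<close>

definition multivariate_gaussian :: "'w measure \<Rightarrow> nat \<Rightarrow> (nat \<Rightarrow> 'w \<Rightarrow> real) \<Rightarrow> bool"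
  where "multivariate_gaussian M k X \<longleftrightarrow>
    (\<forall>a :: nat \<Rightarrow> real. normally_distributed M (\<lambda>\<omega>. \<Sum>i<k. a i * X i \<omega>))"

definition gaussian_field :: "'w measure \<Rightarrow> ('w \<Rightarrow> real^3 \<Rightarrow> real) \<Rightarrow> bool"
  where "gaussian_field M T \<longleftrightarrow>
    (\<forall>k (x :: nat \<Rightarrow> real^3). (\<forall>i<k. x i \<in> sphere2) \<longrightarrow>
       multivariate_gaussian M k (\<lambda>i \<omega>. T \<omega> (x i)))"

definition covariance :: "'w measure \<Rightarrow> ('w \<Rightarrow> real) \<Rightarrow> ('w \<Rightarrow> real) \<Rightarrow> real"
  where "covariance M X Y =
    (\<integral>\<omega>. (X \<omega> - (\<integral>\<omega>'. X \<omega>' \<partial>M)) * (Y \<omega> - (\<integral>\<omega>'. Y \<omega>' \<partial>M)) \<partial>M)"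

definition rotation_invariant_moments :: "'w measure \<Rightarrow> ('w \<Rightarrow> real^3 \<Rightarrow> real) \<Rightarrow> bool"
  where "rotation_invariant_moments M T \<longleftrightarrow>
    (\<forall>R :: real^3^3. rotation_matrix R \<longrightarrow>
       (\<forall>x\<in>sphere2. (\<integral>\<omega>. T \<omega> (R *v x) \<partial>M) = (\<integral>\<omega>. T \<omega> x \<partial>M)) \<and>
       (\<forall>x\<in>sphere2. \<forall>y\<in>sphere2.
          covariance M (\<lambda>\<omega>. T \<omega> (R *v x)) (\<lambda>\<omega>. T \<omega> (R *v y)) =
          covariance M (\<lambda>\<omega>. T \<omega> x) (\<lambda>\<omega>. T \<omega> y)))"

definition isotropic_gaussian_field :: "'w measure \<Rightarrow> ('w \<Rightarrow> real^3 \<Rightarrow> real) \<Rightarrow> bool"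
  where "isotropic_gaussian_field M T \<longleftrightarrow>
    random_field M T \<and> gaussian_field M T \<and> rotation_invariant_moments M T"

definition angular_power_spectrum ::
    "'w measure \<Rightarrow> ('w \<Rightarrow> real^3 \<Rightarrow> real) \<Rightarrow> (nat \<Rightarrow> real) \<Rightarrow> bool"
  where "angular_power_spectrum M T A \<longleftrightarrow> (\<forall>l. A l \<ge> 0) \<and>
    (\<forall>x\<in>sphere2. \<forall>y\<in>sphere2.
       (\<lambda>l. A l * ((2 * real l + 1) / (4 * pi)) * poly (legendre_poly l) (x \<bullet> y))
         sums covariance M (\<lambda>\<omega>. T \<omega> x) (\<lambda>\<omega>. T \<omega> y))"

definition modification ::
    "'w measure \<Rightarrow> ('w \<Rightarrow> real^3 \<Rightarrow> real) \<Rightarrow> ('w \<Rightarrow> real^3 \<Rightarrow> real) \<Rightarrow> bool"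
  where "modification M T T' \<longleftrightarrow> random_field M T' \<and>
    (\<forall>x\<in>sphere2. measure M {\<omega> \<in> space M. T' \<omega> x = T \<omega> x} = 1)"

text \<open>Continuity and Hoelder continuity of paths refer to \<^const>\<open>geodist\<close>. As the sphere is
  compact, Hoelder continuity is taken with one constant for the whole sphere.\<close>

definition geo_continuous :: "(real^3 \<Rightarrow> real) \<Rightarrow> bool"
  where "geo_continuous f \<longleftrightarrow>
    (\<forall>x\<in>sphere2. \<forall>\<epsilon>>0. \<exists>\<delta>>0. \<forall>y\<in>sphere2. geodist x y < \<delta> \<longrightarrow> \<bar>f x - f y\<bar> < \<epsilon>)"

definition geo_hoelder_continuous :: "real \<Rightarrow> (real^3 \<Rightarrow> real) \<Rightarrow> bool"
  where "geo_hoelder_continuous \<gamma> f \<longleftrightarrow>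
    (\<exists>C. \<forall>x\<in>sphere2. \<forall>y\<in>sphere2. \<bar>f x - f y\<bar> \<le> C * geodist x y powr \<gamma>)"

end

theory Submission
  imports Defs
begin

text \<open>
The increment \<open>T x - T y\<close> is a centred normal variable, because the mean of an isotropic field is
constant.  Its variance is \<open>2 (K 1 - K t)\<close>, where \<open>t\<close> is the inner product of \<open>x\<close> and \<open>y\<close> and
\<open>K\<close> is the covariance as a function of \<open>t\<close>; in terms of the spectrum this is
\<open>\<Sum>l. A l (2 l + 1) / (2 \<pi>) (1 - P\<^sub>l t)\<close>.  The Legendre polynomials satisfy
\<open>1 - P\<^sub>l t \<le> 2 min 1 (l (l + 1) (1 - t))\<close> (\<open>abs_legendre_le_1\<close> and \<open>legendre_lipschitz_at_1\<close>),
and \<open>min 1 u \<le> u powr (\<beta> / 2)\<close> since \<open>\<beta> / 2 \<le> 1\<close>.  As \<open>1 - t\<close> is half the squared chordal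
distance of \<open>x\<close> and \<open>y\<close>, the variance is at most a constant times
\<open>(\<Sum>l. A l l powr (1 + \<beta>)) * dist x y powr \<beta>\<close> (\<open>increment_variance_bound\<close>).

For a centred normal variable, the moment of order \<open>2 k\<close> is a multiple of the \<open>k\<close>-th power of the
variance.  So the moments of order \<open>2 k\<close> of the increments are \<open>O (dist x y powr (k \<beta>))\<close> for all
\<open>k > 0\<close>.  The rest is a Kolmogorov-Chentsov argument (\<open>kolmogorov_chentsov_all_moments\<close>) on a bounded
subset \<open>S\<close> of a Euclidean space.  Points of \<open>S\<close> are approximated by finite nets of mesh proportional to
\<open>2 powr (- n)\<close> whose cardinality grows at most exponentially in \<open>n\<close>; since moments of all orders
are controlled, the base of this exponential does not affect the attainable exponents, and a crude
cubic grid suffices.  A union bound shows that almost surely, for all rational \<open>\<gamma> < \<beta> / 2\<close>, the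
increments between nearby points of successive nets are \<open>O (2 powr (- \<gamma> n))\<close>.  On this event \<open>T\<close>
converges along the nets, and the limit is Hoelder continuous with exponent \<open>\<gamma>\<close>; off this event
the modification is defined to be \<open>0\<close>.  All this uses the chordal distance, and carries over to
the geodesic one because chords are shorter than arcs (\<open>dist_le_geodist\<close>).
\<close>

section \<open>Legendre polynomials near 1\<close>

text \<open>
This and the next lemma are Leibniz' rule for a factor of degree at most two, where only the first
terms survive.  They are what is needed to differentiate \<open>(x\<^sup>2 - 1) w' = 2 l x w\<close>
repeatedly for \<open>w = (x\<^sup>2 - 1)\<^sup>l\<close>.
\<close>

lemma pderiv_iterate_X_mult:
  fixes q :: "'a::idom poly"
  shows "(pderiv ^^ Suc n) ([:0, 1:] * q) =
    [:0, 1:] * (pderiv ^^ Suc n) q + of_nat (Suc n) * (pderiv ^^ n) q"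
proof (induction n)
  case 0
  show ?case by (simp add: pderiv_mult pderiv_pCons)
next
  case (Suc n)
  have "(pderiv ^^ Suc (Suc n)) ([:0, 1:] * q) = pderiv ((pderiv ^^ Suc n) ([:0, 1:] * q))"
    by simp
  also have "\<dots> = pderiv ([:0, 1:] * (pderiv ^^ Suc n) q + of_nat (Suc n) * (pderiv ^^ n) q)"
    by (simp only: Suc.IH)
  also have "\<dots> = [:0, 1:] * (pderiv ^^ Suc (Suc n)) q + (of_nat (Suc n) + 1) * (pderiv ^^ Suc n) q"
    by (simp add: pderiv_add pderiv_mult pderiv_pCons pderiv_of_nat algebra_simps
             del: of_nat_Suc mult_pCons_left)
  finally show ?case by (simp add: algebra_simps)
qed

lemma pderiv_iterate_quadratic_mult:
  fixes q :: "'a::idom poly"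
  shows "(pderiv ^^ Suc (Suc n)) ([:-1, 0, 1:] * q) =
    [:-1, 0, 1:] * (pderiv ^^ Suc (Suc n)) q
    + of_nat (2 * (n + 2)) * ([:0, 1:] * (pderiv ^^ Suc n) q)
    + of_nat ((n + 2) * (n + 1)) * (pderiv ^^ n) q"
proof -
  have quad: "pderiv [:-1, 0, 1::'a:] = 2 * [:0, 1:]" by (simp add: pderiv_pCons numeral_poly)
  have X: "pderiv [:0, 1::'a:] = 1" by (simp add: pderiv_pCons)
  show ?thesis
  proof (induction n)
    case 0
    show ?case
      by (simp add: pderiv_add pderiv_mult quad X algebra_simps del: mult_pCons_left mult_pCons_right)
  next
    case (Suc n)
    have "(pderiv ^^ Suc (Suc (Suc n))) ([:-1, 0, 1:] * q)
        = pderiv ((pderiv ^^ Suc (Suc n)) ([:-1, 0, 1:] * q))"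
      by simp
    also have "\<dots> = pderiv ([:-1, 0, 1:] * (pderiv ^^ Suc (Suc n)) q
        + of_nat (2 * (n + 2)) * ([:0, 1:] * (pderiv ^^ Suc n) q)
        + of_nat ((n + 2) * (n + 1)) * (pderiv ^^ n) q)"
      by (simp only: Suc.IH)
    finally show ?case
      by (simp add: pderiv_add pderiv_mult pderiv_of_nat quad X algebra_simps
          del: mult_pCons_left mult_pCons_right)
  qed
qed

text \<open>
Each derivative has to hit one of the \<open>n\<close> factors that vanish at \<open>c\<close>.  With
\<open>x\<^sup>2 - 1 = (x - 1) (x + 1)\<close>, this yields the values of the Legendre polynomials at \<open>1\<close> and \<open>-1\<close>.
\<close>

lemma poly_pderiv_iterate_root_power:
  fixes c :: "'a::{idom, semiring_char_0}"
  shows "poly ((pderiv ^^ n) ([:-c, 1:] ^ n * q)) c = fact n * poly q c"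
proof (induction n arbitrary: q)
  case 0
  show ?case by simp
next
  case (Suc n)
  have d: "pderiv [:-c, 1:] = 1" by (simp add: pderiv_pCons)
  have scale: "smult (of_nat k) p = of_nat k * p" for k and p :: "'a poly"
    by (simp add: of_nat_poly)
  have "pderiv ([:-c, 1:] ^ Suc n * q)
      = [:-c, 1:] ^ n * (of_nat (Suc n) * q + [:-c, 1:] * pderiv q)"
    unfolding pderiv_mult pderiv_power_Suc d scale
    by (simp add: algebra_simps del: mult_pCons_left mult_pCons_right of_nat_Suc)
  then have "poly ((pderiv ^^ Suc n) ([:-c, 1:] ^ Suc n * q)) c
      = fact n * poly (of_nat (Suc n) * q + [:-c, 1:] * pderiv q) c"
    using Suc.IH by (simp only: funpow_Suc_right o_apply)
  then show ?case by (simp add: algebra_simps)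
qed

lemma pCons_quadratic_factor:
  "[:-1, 0, 1::real:] = [:-1, 1:] * [:1, 1:]"
  by simp

lemma poly_legendre_1: "poly (legendre_poly l) 1 = 1"
proof -
  have "poly ((pderiv ^^ l) ([:-1, 0, 1::real:] ^ l)) 1 = fact l * poly ([:1, 1:] ^ l) 1"
    unfolding pCons_quadratic_factor power_mult_distrib
    by (rule poly_pderiv_iterate_root_power)
  then show ?thesis by (simp add: legendre_poly_def poly_power)
qed

lemma abs_poly_legendre_minus_1: "\<bar>poly (legendre_poly l) (-1)\<bar> = 1"
proof -
  have "poly ((pderiv ^^ l) ([:-1, 0, 1::real:] ^ l)) (-1) = fact l * poly ([:-1, 1:] ^ l) (-1)"
    unfolding pCons_quadratic_factor power_mult_distrib mult.commute[of "[:-1, 1:] ^ l"]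
    using poly_pderiv_iterate_root_power[of l "-1::real" "[:-1, 1:] ^ l"] by simp
  then show ?thesis by (simp add: legendre_poly_def poly_power abs_mult power_abs)
qed

text \<open>
Legendre's differential equation.  The polynomial \<open>w = (x\<^sup>2 - 1)\<^sup>l\<close> satisfies
\<open>(x\<^sup>2 - 1) w' = 2 l x w\<close>, and differentiating this \<open>l + 1\<close> times gives the equation for
the \<open>l\<close>-th derivative of \<open>w\<close>.
\<close>

lemma legendre_equation_poly:
  "[:-1, 0, 1:] * pderiv (pderiv (legendre_poly l)) + 2 * ([:0, 1:] * pderiv (legendre_poly l))
    = of_nat (l * (l + 1)) * legendre_poly l"
proof (cases l)
  case 0
  then show ?thesis by (simp add: legendre_poly_def)
next
  case (Suc m)
  define w :: "real poly" where "w = [:-1, 0, 1:] ^ l"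
  define D where "D = (pderiv ^^ l) w"
  have quad: "pderiv [:-1, 0, 1::real:] = 2 * [:0, 1:]" by (simp add: pderiv_pCons numeral_poly)
  have scale: "smult (of_nat k) p = of_nat k * p" for k and p :: "real poly"
    by (simp add: of_nat_poly)
  have w': "[:-1, 0, 1:] * pderiv w = of_nat (2 * l) * ([:0, 1:] * w)"
    unfolding w_def Suc pderiv_power_Suc quad scale
    by (simp add: algebra_simps del: mult_pCons_left mult_pCons_right)
  have pull: "(pderiv ^^ n) (of_nat k * q) = of_nat k * (pderiv ^^ n) q" for n k and q :: "real poly"
    by (induction n) (simp_all add: pderiv_mult pderiv_of_nat)
  have shift: "(pderiv ^^ n) (pderiv q) = (pderiv ^^ Suc n) q" for n and q :: "real poly"
    by (simp add: funpow_swap1)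
  have "(pderiv ^^ Suc l) ([:-1, 0, 1:] * pderiv w)
      = [:-1, 0, 1:] * pderiv (pderiv D) + of_nat (2 * (l + 1)) * ([:0, 1:] * pderiv D)
        + of_nat ((l + 1) * l) * D"
    unfolding Suc pderiv_iterate_quadratic_mult shift
    by (simp add: D_def Suc algebra_simps del: mult_pCons_left mult_pCons_right)
  moreover have "(pderiv ^^ Suc l) (of_nat (2 * l) * ([:0, 1:] * w))
      = of_nat (2 * l) * ([:0, 1:] * pderiv D + of_nat (Suc l) * D)"
    unfolding pull pderiv_iterate_X_mult by (simp add: D_def del: of_nat_Suc mult_pCons_left)
  ultimately have "[:-1, 0, 1:] * pderiv (pderiv D) + 2 * ([:0, 1:] * pderiv D)
      = of_nat (l * (l + 1)) * D"
    using w' by (simp add: algebra_simps del: mult_pCons_left mult_pCons_right)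
  then have "smult c ([:-1, 0, 1:] * pderiv (pderiv D) + 2 * ([:0, 1:] * pderiv D))
      = smult c (of_nat (l * (l + 1)) * D)" for c
    by (rule arg_cong)
  then show ?thesis
    unfolding legendre_poly_def w_def[symmetric] D_def[symmetric] pderiv_smult
    by (simp only: mult_smult_right smult_add_right)
qed

lemma legendre_equation:
  fixes x :: real
  shows "(1 - x\<^sup>2) * poly (pderiv (pderiv (legendre_poly l))) x
    = 2 * x * poly (pderiv (legendre_poly l)) x - real (l * (l + 1)) * poly (legendre_poly l) x"
  using arg_cong[OF legendre_equation_poly[of l], of "\<lambda>p. poly p x"]
  by (simp add: algebra_simps power2_eq_square)

text \<open>
By Legendre's equation, the energy \<open>l (l + 1) f\<^sup>2 + (1 - x\<^sup>2) f'\<^sup>2\<close> of \<open>f = P\<^sub>l\<close> has derivative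
\<open>2 x f'\<^sup>2\<close>.  It therefore decreases on \<open>[-1, 0]\<close> and increases on \<open>[0, 1]\<close>, so it is bounded by
its value \<open>l (l + 1)\<close> at the two end points.
\<close>

lemma abs_legendre_le_1:
  assumes x: "\<bar>x\<bar> \<le> 1"
  shows "\<bar>poly (legendre_poly l) x\<bar> \<le> 1"
proof (cases "l = 0")
  case True
  then show ?thesis by (simp add: legendre_poly_def)
next
  case False
  define N where "N = real (l * (l + 1))"
  have N: "N > 0" using False unfolding N_def of_nat_0_less_iff by simp
  define f where "f = poly (legendre_poly l)"
  define f' where "f' = poly (pderiv (legendre_poly l))"
  define f'' where "f'' = poly (pderiv (pderiv (legendre_poly l)))"
  have d: "(f has_real_derivative f' t) (at t)" "(f' has_real_derivative f'' t) (at t)" for t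
    unfolding f_def f'_def f''_def by (rule poly_DERIV)+
  define h where "h = (\<lambda>t. N * (f t)\<^sup>2 + (1 - t\<^sup>2) * (f' t)\<^sup>2)"
  have h': "(h has_real_derivative 2 * t * (f' t)\<^sup>2) (at t)" for t
  proof -
    have "(h has_real_derivative
        N * (2 * f t * f' t) + ((1 - t\<^sup>2) * (2 * f' t * f'' t) + (- (2 * t)) * (f' t)\<^sup>2)) (at t)"
      unfolding h_def by (auto intro!: derivative_eq_intros d simp: power2_eq_square)
    moreover have "(1 - t\<^sup>2) * f'' t = 2 * t * f' t - N * f t"
      unfolding f_def f'_def f''_def N_def by (rule legendre_equation)
    then have "(1 - t\<^sup>2) * (2 * f' t * f'' t) = 2 * f' t * (2 * t * f' t - N * f t)"
      by (metis mult.assoc mult.commute)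
    ultimately show ?thesis by (simp add: algebra_simps power2_eq_square)
  qed
  have "h x \<le> N"
  proof (cases "x \<ge> 0")
    case True
    have "h x \<le> h 1"
      using x True by (intro DERIV_nonneg_imp_nondecreasing[of x 1 h]) (auto intro!: exI[of _ "2 * _ * _"] h')
    then show ?thesis by (simp add: h_def f_def poly_legendre_1)
  next
    case False
    have "\<exists>y. (h has_real_derivative y) (at t) \<and> y \<le> 0" if "t \<le> x" for t
    proof (intro exI conjI)
      show "2 * t * (f' t)\<^sup>2 \<le> 0" using that False by (simp add: mult_nonpos_nonneg)
    qed (rule h')
    then have "h x \<le> h (-1)"
      using x by (intro DERIV_nonpos_imp_nonincreasing[of "-1" x h]) auto
    moreover have "(f (-1))\<^sup>2 = 1"
      using abs_poly_legendre_minus_1[of l] unfolding f_def by (metis power2_abs one_power2)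
    ultimately show ?thesis by (simp add: h_def)
  qed
  moreover have "x\<^sup>2 \<le> 1" using x by (simp add: abs_square_le_1)
  then have "N * (f x)\<^sup>2 \<le> h x" by (simp add: h_def)
  ultimately have "N * (f x)\<^sup>2 \<le> N * 1" by simp
  then have "(f x)\<^sup>2 \<le> 1" using N by (simp only: mult_le_cancel_left_pos)
  then show ?thesis unfolding f_def by (simp only: abs_square_le_1)
qed

text \<open>
Legendre's equation says that \<open>(1 - x\<^sup>2) P\<^sub>l'\<close> has derivative \<open>- l (l + 1) P\<^sub>l\<close>, and this function
vanishes at \<open>1\<close>.  Since \<open>P\<^sub>l\<close> is bounded by \<open>1\<close>, the mean value theorem gives
\<open>(1 + x) \<bar>P\<^sub>l' x\<bar> \<le> l (l + 1)\<close>, which bounds \<open>P\<^sub>l'\<close> on \<open>[0, 1)\<close>.  For \<open>x < 0\<close> the claim is weaker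
than the bound \<open>2\<close> on the left-hand side.
\<close>

lemma legendre_lipschitz_at_1:
  assumes x: "\<bar>x\<bar> \<le> 1"
  shows "1 - poly (legendre_poly l) x \<le> 2 * real (l * (l + 1)) * (1 - x)"
proof (cases "l = 0 \<or> x = 1")
  case True
  then show ?thesis
  proof
    assume "l = 0"
    then show ?thesis by (simp add: legendre_poly_def)
  qed (simp add: poly_legendre_1)
next
  case False
  define N where "N = real (l * (l + 1))"
  have N: "N \<ge> 1"
  proof -
    have "1 \<le> l * (l + 1)" using False by (simp add: Suc_leI)
    then show ?thesis unfolding N_def by (metis of_nat_1 of_nat_le_iff)
  qed
  define f where "f = poly (legendre_poly l)"
  define f' where "f' = poly (pderiv (legendre_poly l))"
  define f'' where "f'' = poly (pderiv (pderiv (legendre_poly l)))"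
  have d: "(f has_real_derivative f' t) (at t)" "(f' has_real_derivative f'' t) (at t)" for t
    unfolding f_def f'_def f''_def by (rule poly_DERIV)+
  have f1: "f 1 = 1" by (simp add: f_def poly_legendre_1)
  have fle: "\<bar>f t\<bar> \<le> 1" if "\<bar>t\<bar> \<le> 1" for t
    using abs_legendre_le_1[OF that] by (simp add: f_def)
  show ?thesis
  proof (cases "x \<ge> 0")
    case True
    have f'le: "\<bar>f' t\<bar> \<le> N" if t: "0 \<le> t" "t < 1" for t
    proof -
      define g where "g = (\<lambda>t. (1 - t\<^sup>2) * f' t)"
      have g': "(g has_real_derivative - N * f s) (at s)" for s
      proof -
        have "(g has_real_derivative (1 - s\<^sup>2) * f'' s + (- (2 * s)) * f' s) (at s)"
          unfolding g_def by (auto intro!: derivative_eq_intros d simp: power2_eq_square)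
        moreover have "(1 - s\<^sup>2) * f'' s = 2 * s * f' s - N * f s"
          unfolding f_def f'_def f''_def N_def by (rule legendre_equation)
        ultimately show ?thesis by simp
      qed
      obtain s where s: "t < s" "s < 1" "g 1 - g t = (1 - t) * (- N * f s)"
        using MVT2[OF t(2) g'] by blast
      have "(1 - t) * ((1 + t) * f' t) = (1 - t) * (N * f s)"
        using s(3) by (simp add: g_def power2_eq_square algebra_simps)
      then have "(1 + t) * f' t = N * f s" using t by simp
      then have "\<bar>f' t\<bar> * (1 + t) = N * \<bar>f s\<bar>"
        using t N by (metis abs_mult abs_of_nonneg add_nonneg_nonneg mult.commute
            order_trans zero_le_one)
      also have "\<dots> \<le> N" using fle[of s] s t N by (simp add: mult_left_le)
      finally have "\<bar>f' t\<bar> * (1 + t) \<le> N" .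
      moreover have "\<bar>f' t\<bar> * 1 \<le> \<bar>f' t\<bar> * (1 + t)" using t by (intro mult_left_mono) auto
      ultimately show ?thesis by simp
    qed
    have "x < 1" using x False by auto
    then obtain t where t: "x < t" "t < 1" "f 1 - f x = (1 - x) * f' t"
      using MVT2[of x 1 f f'] d(1) by blast
    have "(1 - x) * f' t \<le> (1 - x) * N"
      using f'le[of t] t True by (intro mult_left_mono) auto
    also have "\<dots> \<le> 2 * N * (1 - x)" using N x by (auto intro: mult_right_mono simp: mult.commute)
    finally show ?thesis using t(3) f1 by (simp add: f_def N_def)
  next
    case False
    have "1 - f x \<le> 2 * 1 * 1" using fle[OF x] by linarith
    also have "\<dots> \<le> 2 * N * (1 - x)" using N False by (intro mult_mono) auto
    finally show ?thesis by (simp add: f_def N_def)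
  qed
qed

text \<open>
Interpolation between the two bounds \<open>2\<close> and \<open>2 u\<close>, where \<open>u = l (l + 1) (1 - x)\<close>: the smaller of
\<open>1\<close> and \<open>u\<close> is at most \<open>u powr b\<close>.
\<close>

lemma one_minus_legendre_le_powr:
  assumes x: "\<bar>x\<bar> \<le> 1" and b: "0 < b" "b \<le> 1"
  shows "1 - poly (legendre_poly l) x \<le> 2 * (real (l * (l + 1)) * (1 - x)) powr b"
proof -
  define u where "u = real (l * (l + 1)) * (1 - x)"
  have u: "u \<ge> 0" using x unfolding u_def by (intro mult_nonneg_nonneg) auto
  have "1 - poly (legendre_poly l) x \<le> 2 * u powr b"
  proof (cases "u \<le> 1")
    case True
    have "u \<le> u powr b"
    proof (cases "u = 0")
      case False
      have "u powr 1 \<le> u powr b" using u True b False by (intro powr_mono') auto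
      then show ?thesis using u False by simp
    qed simp
    then have "2 * real (l * (l + 1)) * (1 - x) \<le> 2 * u powr b"
      unfolding u_def by (simp only: mult.assoc)
    with legendre_lipschitz_at_1[OF x, of l] show ?thesis by linarith
  next
    case False
    then have "1 \<le> u powr b" using b by (intro ge_one_powr_ge_zero) auto
    with abs_legendre_le_1[OF x, of l] show ?thesis by linarith
  qed
  then show ?thesis by (simp add: u_def)
qed

section \<open>Moments of the increments\<close>

lemma (in prob_space) normally_distributed_square_integrable:
  assumes "normally_distributed M X"
  shows "integrable M (\<lambda>\<omega>. (X \<omega>)\<^sup>2)"
proof -
  have X[measurable]: "X \<in> borel_measurable M"
    using assms by (simp add: normally_distributed_def)
  consider \<mu> \<sigma> where "\<sigma> > 0" "distributed M lborel X (normal_density \<mu> \<sigma>)"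
    | \<mu> where "AE \<omega> in M. X \<omega> = \<mu>"
    using assms unfolding normally_distributed_def by blast
  then show ?thesis
  proof cases
    case 1
    have mom: "integrable M (\<lambda>\<omega>. (X \<omega> - \<mu>) ^ k)" for k
      using distributed_integrable[OF 1(2), of "\<lambda>x. (x - \<mu>) ^ k"] integrable_normal_moment[OF 1(1), of \<mu> k]
      by simp
    have "integrable M (\<lambda>\<omega>. (X \<omega> - \<mu>) ^ 2 + 2 * \<mu> * (X \<omega> - \<mu>) ^ 1 + \<mu>\<^sup>2)"
      by (intro Bochner_Integration.integrable_add integrable_mult_right mom integrable_const)
    then show ?thesis by (simp add: power2_eq_square algebra_simps)
  next
    case 2
    have "integrable M (\<lambda>\<omega>. (X \<omega>)\<^sup>2) \<longleftrightarrow> integrable M (\<lambda>\<omega>. \<mu>\<^sup>2)"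
      using 2 by (intro integrable_cong_AE) auto
    then show ?thesis by simp
  qed
qed

text \<open>
The constant is \<open>(2 k - 1)!!\<close>.  A degenerate law with mean \<open>0\<close> is concentrated at \<open>0\<close>; there
both sides vanish because \<open>k > 0\<close>.
\<close>

lemma (in prob_space) normally_distributed_even_moment:
  assumes X: "normally_distributed M X" and mean: "expectation X = 0" and k: "k > 0"
  shows "(\<integral>\<^sup>+\<omega>. ennreal ((X \<omega>) ^ (2 * k)) \<partial>M)
    = ennreal (fact (2 * k) / (2 ^ k * fact k) * (expectation (\<lambda>\<omega>. (X \<omega>)\<^sup>2)) ^ k)"
proof -
  have [measurable]: "X \<in> borel_measurable M"
    using X by (simp add: normally_distributed_def)
  consider \<mu> \<sigma> where "\<sigma> > 0" "distributed M lborel X (normal_density \<mu> \<sigma>)"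
    | \<mu> where "AE \<omega> in M. X \<omega> = \<mu>"
    using X unfolding normally_distributed_def by blast
  then show ?thesis
  proof cases
    case 1
    have \<mu>: "\<mu> = 0" using normal_distributed_expectation[OF 1] mean by simp
    have sq: "expectation (\<lambda>\<omega>. (X \<omega>)\<^sup>2) = \<sigma>\<^sup>2"
      using normal_distributed_variance[OF 1] mean by simp
    have "integrable M (\<lambda>\<omega>. (X \<omega>) ^ (2 * k))"
      using distributed_integrable[OF 1(2), of "\<lambda>x. x ^ (2 * k)"]
        integrable_normal_moment[OF 1(1), of \<mu> "2 * k"] by (simp add: \<mu>)
    then have "(\<integral>\<^sup>+\<omega>. ennreal ((X \<omega>) ^ (2 * k)) \<partial>M) = ennreal (\<integral>\<omega>. (X \<omega>) ^ (2 * k) \<partial>M)"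
      by (intro nn_integral_eq_integral) auto
    also have "(\<integral>\<omega>. (X \<omega>) ^ (2 * k) \<partial>M) = (\<integral>x. normal_density \<mu> \<sigma> x * (x - \<mu>) ^ (2 * k) \<partial>lborel)"
      using distributed_integral[OF 1(2), of "\<lambda>x. x ^ (2 * k)"] by (simp add: \<mu>)
    also have "\<dots> = fact (2 * k) / ((2 / \<sigma>\<^sup>2) ^ k * fact k)"
      by (rule integral_normal_moment_even[OF 1(1)])
    also have "\<dots> = fact (2 * k) / (2 ^ k * fact k) * (\<sigma>\<^sup>2) ^ k"
      using 1(1) by (simp add: power_divide field_simps)
    finally show ?thesis by (simp add: sq)
  next
    case 2
    then have "expectation X = (\<integral>\<omega>. \<mu> \<partial>M)" by (intro integral_cong_AE) auto
    with mean have "\<mu> = 0" by (simp add: prob_space)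
    with 2 have ae: "AE \<omega> in M. X \<omega> = 0" by simp
    then have "(\<integral>\<^sup>+\<omega>. ennreal ((X \<omega>) ^ (2 * k)) \<partial>M) = (\<integral>\<^sup>+\<omega>. 0 \<partial>M)"
      using k by (intro nn_integral_cong_AE) auto
    moreover have "expectation (\<lambda>\<omega>. (X \<omega>)\<^sup>2) = (\<integral>\<omega>. 0 \<partial>M)"
      using ae by (intro integral_cong_AE) auto
    ultimately show ?thesis using k by simp
  qed
qed

lemma (in prob_space) expectation_diff_square:
  fixes X Y :: "'a \<Rightarrow> real"
  assumes [measurable]: "X \<in> borel_measurable M" "Y \<in> borel_measurable M"
    and X2: "integrable M (\<lambda>\<omega>. (X \<omega>)\<^sup>2)" and Y2: "integrable M (\<lambda>\<omega>. (Y \<omega>)\<^sup>2)"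
    and mean: "expectation X = expectation Y"
  shows "expectation (\<lambda>\<omega>. (X \<omega> - Y \<omega>)\<^sup>2)
    = covariance M X X + covariance M Y Y - 2 * covariance M X Y"
proof -
  define m where "m = expectation X"
  have m: "expectation X = m" "expectation Y = m" using mean by (simp_all add: m_def)
  have X1: "integrable M X" and Y1: "integrable M Y"
    using X2 Y2 by (auto intro: square_integrable_imp_integrable)
  have XX: "integrable M (\<lambda>\<omega>. (X \<omega> - m)\<^sup>2)" and YY: "integrable M (\<lambda>\<omega>. (Y \<omega> - m)\<^sup>2)"
    unfolding power2_diff using X1 Y1 X2 Y2 by auto
  have XY: "integrable M (\<lambda>\<omega>. (X \<omega> - m) * (Y \<omega> - m))"
  proof (rule Bochner_Integration.integrable_bound)
    show "integrable M (\<lambda>\<omega>. (X \<omega> - m)\<^sup>2 + (Y \<omega> - m)\<^sup>2)" using XX YY by auto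
    have "\<bar>a * b\<bar> \<le> a\<^sup>2 + b\<^sup>2" for a b :: real
    proof -
      have "2 * (\<bar>a\<bar> * \<bar>b\<bar>) \<le> a\<^sup>2 + b\<^sup>2"
        using sum_squares_bound[of "\<bar>a\<bar>" "\<bar>b\<bar>"] by (simp add: mult.assoc)
      moreover have "0 \<le> \<bar>a\<bar> * \<bar>b\<bar>" by simp
      ultimately show ?thesis unfolding abs_mult by linarith
    qed
    then show "AE \<omega> in M. norm ((X \<omega> - m) * (Y \<omega> - m)) \<le> norm ((X \<omega> - m)\<^sup>2 + (Y \<omega> - m)\<^sup>2)"
      by simp
  qed simp
  have "expectation (\<lambda>\<omega>. (X \<omega> - Y \<omega>)\<^sup>2)
      = expectation (\<lambda>\<omega>. (X \<omega> - m)\<^sup>2 + (Y \<omega> - m)\<^sup>2 - 2 * ((X \<omega> - m) * (Y \<omega> - m)))"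
    by (intro Bochner_Integration.integral_cong) (auto simp: power2_eq_square algebra_simps)
  also have "\<dots> = expectation (\<lambda>\<omega>. (X \<omega> - m)\<^sup>2) + expectation (\<lambda>\<omega>. (Y \<omega> - m)\<^sup>2)
      - 2 * expectation (\<lambda>\<omega>. (X \<omega> - m) * (Y \<omega> - m))"
    using XX YY XY by simp
  finally show ?thesis by (simp add: covariance_def m power2_eq_square)
qed

lemma gaussian_field_marginal:
  assumes "gaussian_field M T" "x \<in> sphere2"
  shows "normally_distributed M (\<lambda>\<omega>. T \<omega> x)"
proof -
  have "multivariate_gaussian M 1 (\<lambda>i \<omega>. T \<omega> x)"
    using assms(1)[unfolded gaussian_field_def, rule_format, of 1 "\<lambda>_. x"] assms(2) by simp
  from this[unfolded multivariate_gaussian_def, rule_format, of "\<lambda>_. 1"] show ?thesis by simp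
qed

lemma gaussian_field_increment:
  assumes "gaussian_field M T" and x: "x \<in> sphere2" and y: "y \<in> sphere2"
  shows "normally_distributed M (\<lambda>\<omega>. T \<omega> x - T \<omega> y)"
proof -
  define p where "p i = (if i = (0::nat) then x else y)" for i
  define a where "a i = (if i = (0::nat) then 1 else - 1 :: real)" for i
  have "\<forall>i<2. p i \<in> sphere2" using x y by (simp add: p_def)
  then have "multivariate_gaussian M 2 (\<lambda>i \<omega>. T \<omega> (p i))"
    using assms(1)[unfolded gaussian_field_def, rule_format, of 2 p] by simp
  from this[unfolded multivariate_gaussian_def, rule_format, of a] show ?thesis by (simp add: numeral_2_eq_2 p_def a_def)
qed

text \<open>
The rotations act transitively on the sphere: each point is the image of a fixed coordinate vector.
\<close>

lemma rotation_invariant_mean_constant: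
  assumes "rotation_invariant_moments M T" "x \<in> sphere2" "y \<in> sphere2"
  shows "(\<integral>\<omega>. T \<omega> x \<partial>M) = (\<integral>\<omega>. T \<omega> y \<partial>M)"
proof -
  define e :: "real^3" where "e = axis 1 1"
  have e: "e \<in> sphere2" by (simp add: e_def)
  have "(\<integral>\<omega>. T \<omega> z \<partial>M) = (\<integral>\<omega>. T \<omega> e \<partial>M)" if "z \<in> sphere2" for z
  proof -
    have "norm z = 1" using that by simp
    then obtain R :: "real^3^3" where R: "rotation_matrix R" "R *v e = z"
      unfolding e_def using rotation_matrix_exists_basis[of z 1] by auto
    then show ?thesis using assms(1) e unfolding rotation_invariant_moments_def by metis
  qed
  with assms(2,3) show ?thesis by simp
qed

lemma one_minus_inner_sphere:
  fixes x y :: "'a::real_inner"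
  assumes "norm x = 1" "norm y = 1"
  shows "1 - x \<bullet> y = (dist x y)\<^sup>2 / 2"
proof -
  have "x \<bullet> x = 1" "y \<bullet> y = 1" using assms by (auto simp: norm_eq_1)
  then show ?thesis
    unfolding dist_norm power2_norm_eq_inner by (simp add: inner_simps inner_commute)
qed

lemma abs_inner_sphere_le_1:
  fixes x y :: "'a::real_inner"
  assumes "norm x = 1" "norm y = 1"
  shows "\<bar>x \<bullet> y\<bar> \<le> 1"
  using Cauchy_Schwarz_ineq2[of x y] assms by simp

lemma legendre_increment_bound:
  fixes x y :: "real^3"
  assumes xy: "x \<in> sphere2" "y \<in> sphere2" and b: "0 < \<beta>" "\<beta> \<le> 2"
  shows "(2 * real l + 1) / (2 * pi) * (1 - poly (legendre_poly l) (x \<bullet> y))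
    \<le> 3 / pi * dist x y powr \<beta> * real l powr (1 + \<beta>)"
proof (cases "l = 0")
  case True
  then show ?thesis by (simp add: legendre_poly_def)
next
  case False
  define d where "d = dist x y"
  have d: "d \<ge> 0" by (simp add: d_def)
  have n: "norm x = 1" "norm y = 1" using xy by auto
  have l1: "real l \<ge> 1" using False by simp
  have "real (l * (l + 1)) * (1 - x \<bullet> y) \<le> (2 * (real l)\<^sup>2) * (d\<^sup>2 / 2)"
    unfolding one_minus_inner_sphere[OF n] d_def
    using l1 by (intro mult_right_mono) (auto simp: power2_eq_square algebra_simps intro: mult_left_le)
  then have le: "real (l * (l + 1)) * (1 - x \<bullet> y) \<le> (real l * d)\<^sup>2"
    by (simp add: power_mult_distrib)
  have "1 - poly (legendre_poly l) (x \<bullet> y) \<le> 2 * (real (l * (l + 1)) * (1 - x \<bullet> y)) powr (\<beta> / 2)"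
    using abs_inner_sphere_le_1[OF n] b by (intro one_minus_legendre_le_powr) auto
  also have "\<dots> \<le> 2 * ((real l * d)\<^sup>2) powr (\<beta> / 2)"
    using le abs_inner_sphere_le_1[OF n] b
    by (intro mult_left_mono powr_mono2 mult_nonneg_nonneg) auto
  also have "((real l * d)\<^sup>2) powr (\<beta> / 2) = (real l * d) powr \<beta>"
    using d l1 by (simp add: powr_powr flip: powr_numeral)
  also have "\<dots> = real l powr \<beta> * d powr \<beta>" using d by (simp add: powr_mult)
  finally have P: "1 - poly (legendre_poly l) (x \<bullet> y) \<le> 2 * (real l powr \<beta> * d powr \<beta>)" .
  have "(2 * real l + 1) / (2 * pi) * (1 - poly (legendre_poly l) (x \<bullet> y))
      \<le> (3 * real l) / (2 * pi) * (2 * (real l powr \<beta> * d powr \<beta>))"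
    using P l1 abs_legendre_le_1[OF abs_inner_sphere_le_1[OF n], of l]
    by (intro mult_mono divide_right_mono) auto
  also have "\<dots> = 3 / pi * d powr \<beta> * real l powr (1 + \<beta>)"
    using l1 by (simp add: powr_add)
  finally show ?thesis by (simp add: d_def)
qed

text \<open>
The spectral series of the variance of an increment is compared with
\<open>\<Sum>l. A l * real l powr (1 + \<beta>)\<close> term by term.
\<close>

lemma increment_variance_bound:
  assumes M: "prob_space M" and T: "isotropic_gaussian_field M T"
    and A: "angular_power_spectrum M T A"
    and b: "0 < \<beta>" "\<beta> \<le> 2" and S: "summable (\<lambda>l. A l * real l powr (1 + \<beta>))"
    and xy: "x \<in> sphere2" "y \<in> sphere2"
  shows "(\<integral>\<omega>. (T \<omega> x - T \<omega> y)\<^sup>2 \<partial>M)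
    \<le> 3 / pi * (\<Sum>l. A l * real l powr (1 + \<beta>)) * dist x y powr \<beta>"
proof -
  interpret prob_space M by fact
  define a where "a l = A l * ((2 * real l + 1) / (4 * pi))" for l
  have gf: "gaussian_field M T" and ri: "rotation_invariant_moments M T"
    using T by (auto simp: isotropic_gaussian_field_def)
  have nd: "normally_distributed M (\<lambda>\<omega>. T \<omega> z)" if "z \<in> sphere2" for z
    using gaussian_field_marginal[OF gf that] .
  have meas: "(\<lambda>\<omega>. T \<omega> z) \<in> borel_measurable M" if "z \<in> sphere2" for z
    using nd[OF that] by (simp add: normally_distributed_def)
  have cov: "(\<lambda>l. a l * poly (legendre_poly l) (u \<bullet> v)) sums covariance M (\<lambda>\<omega>. T \<omega> u) (\<lambda>\<omega>. T \<omega> v)"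
    if "u \<in> sphere2" "v \<in> sphere2" for u v
    using A that unfolding angular_power_spectrum_def a_def by blast
  have diag: "a sums covariance M (\<lambda>\<omega>. T \<omega> u) (\<lambda>\<omega>. T \<omega> u)" if "u \<in> sphere2" for u
  proof -
    have "u \<bullet> u = 1" using that by (simp add: dot_square_norm)
    then show ?thesis using cov[OF that that] by (simp add: poly_legendre_1)
  qed
  have eq: "(\<integral>\<omega>. (T \<omega> x - T \<omega> y)\<^sup>2 \<partial>M)
      = covariance M (\<lambda>\<omega>. T \<omega> x) (\<lambda>\<omega>. T \<omega> x) + covariance M (\<lambda>\<omega>. T \<omega> y) (\<lambda>\<omega>. T \<omega> y)
        - 2 * covariance M (\<lambda>\<omega>. T \<omega> x) (\<lambda>\<omega>. T \<omega> y)"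
    by (intro expectation_diff_square meas normally_distributed_square_integrable nd xy
        rotation_invariant_mean_constant[OF ri])
  have lhs: "(\<lambda>l. a l + a l - 2 * (a l * poly (legendre_poly l) (x \<bullet> y))) sums
      (\<integral>\<omega>. (T \<omega> x - T \<omega> y)\<^sup>2 \<partial>M)"
    unfolding eq by (intro sums_diff sums_add sums_mult diag cov xy)
  have rhs: "(\<lambda>l. 3 / pi * dist x y powr \<beta> * (A l * real l powr (1 + \<beta>))) sums
      (3 / pi * dist x y powr \<beta> * (\<Sum>l. A l * real l powr (1 + \<beta>)))"
    using S by (intro sums_mult summable_sums)
  have "a l + a l - 2 * (a l * poly (legendre_poly l) (x \<bullet> y))
      \<le> 3 / pi * dist x y powr \<beta> * (A l * real l powr (1 + \<beta>))" for l
  proof -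
    have "A l \<ge> 0" using A by (simp add: angular_power_spectrum_def)
    from mult_left_mono[OF legendre_increment_bound[OF xy b, of l] this]
    have "A l * ((2 * real l + 1) / (2 * pi) * (1 - poly (legendre_poly l) (x \<bullet> y)))
        \<le> 3 / pi * dist x y powr \<beta> * (A l * real l powr (1 + \<beta>))"
      by (simp only: mult.assoc mult.left_commute mult.commute)
    moreover have "a l + a l - 2 * (a l * poly (legendre_poly l) (x \<bullet> y))
        = A l * ((2 * real l + 1) / (2 * pi) * (1 - poly (legendre_poly l) (x \<bullet> y)))"
      by (simp add: a_def field_simps)
    ultimately show ?thesis by simp
  qed
  from sums_le[OF this lhs rhs] show ?thesis by (simp add: mult_ac)
qed

lemma increment_moment_bound:
  assumes M: "prob_space M" and T: "isotropic_gaussian_field M T"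
    and A: "angular_power_spectrum M T A"
    and b: "0 < \<beta>" "\<beta> \<le> 2" and S: "summable (\<lambda>l. A l * real l powr (1 + \<beta>))"
    and k: "k > 0"
  shows "\<exists>C. \<forall>x\<in>sphere2. \<forall>y\<in>sphere2.
    (\<integral>\<^sup>+\<omega>. ennreal ((T \<omega> x - T \<omega> y) ^ (2 * k)) \<partial>M) \<le> ennreal (C * dist x y powr (real (2 * k) * (\<beta> / 2)))"
proof -
  interpret prob_space M by fact
  have gf: "gaussian_field M T" and ri: "rotation_invariant_moments M T"
    using T by (auto simp: isotropic_gaussian_field_def)
  define K where "K = 3 / pi * (\<Sum>l. A l * real l powr (1 + \<beta>))"
  define c :: real where "c = fact (2 * k) / (2 ^ k * fact k)"
  have "(\<integral>\<^sup>+\<omega>. ennreal ((T \<omega> x - T \<omega> y) ^ (2 * k)) \<partial>M)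
      \<le> ennreal ((c * K ^ k) * dist x y powr (real (2 * k) * (\<beta> / 2)))"
    if xy: "x \<in> sphere2" "y \<in> sphere2" for x y
  proof -
    have int: "integrable M (\<lambda>\<omega>. T \<omega> z)" if "z \<in> sphere2" for z
    proof (rule square_integrable_imp_integrable)
      note nd = gaussian_field_marginal[OF gf that]
      show "(\<lambda>\<omega>. T \<omega> z) \<in> borel_measurable M"
        using nd by (simp add: normally_distributed_def)
      show "integrable M (\<lambda>\<omega>. (T \<omega> z)\<^sup>2)"
        by (rule normally_distributed_square_integrable[OF nd])
    qed
    have "expectation (\<lambda>\<omega>. T \<omega> x - T \<omega> y) = 0"
      using int[OF xy(1)] int[OF xy(2)] rotation_invariant_mean_constant[OF ri xy] by simp
    then have "(\<integral>\<^sup>+\<omega>. ennreal ((T \<omega> x - T \<omega> y) ^ (2 * k)) \<partial>M)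
        = ennreal (c * (expectation (\<lambda>\<omega>. (T \<omega> x - T \<omega> y)\<^sup>2)) ^ k)"
      unfolding c_def by (intro normally_distributed_even_moment gaussian_field_increment gf xy k)
    also have "\<dots> \<le> ennreal (c * (K * dist x y powr \<beta>) ^ k)"
      using increment_variance_bound[OF M T A b S xy]
      by (intro ennreal_leI mult_left_mono power_mono integral_nonneg_AE) (auto simp: c_def K_def)
    also have "c * (K * dist x y powr \<beta>) ^ k = c * K ^ k * dist x y powr (real (2 * k) * (\<beta> / 2))"
    proof -
      have "(dist x y powr \<beta>) ^ k = dist x y powr (\<beta> * real k)"
        using k by (cases "x = y") (simp_all add: powr_power mult.commute)
      then show ?thesis by (simp add: power_mult_distrib mult.commute)
    qed
    finally show ?thesis .
  qed
  then show ?thesis by blast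
qed


section \<open>A Kolmogorov-Chentsov theorem\<close>

text \<open>
The maps \<open>\<pi> n\<close> send a point of \<open>S\<close> to a nearby point of the finite net \<open>\<pi> n ` S\<close>.  The mesh at
level \<open>0\<close> bounds the diameter of \<open>S\<close>, so that any two distinct points have a distance that is
comparable to the mesh at some level.
\<close>

locale dyadic_nets =
  fixes S :: "'a::euclidean_space set" and \<pi> :: "nat \<Rightarrow> 'a \<Rightarrow> 'a" and R B D :: real
  assumes R_pos: "R > 0" and D_ge_1: "D \<ge> 1"
    and dist_le_R: "\<And>x y. x \<in> S \<Longrightarrow> y \<in> S \<Longrightarrow> dist x y \<le> R"
    and net_in: "\<And>n x. x \<in> S \<Longrightarrow> \<pi> n x \<in> S"
    and net_dist: "\<And>n x. x \<in> S \<Longrightarrow> dist x (\<pi> n x) \<le> R / 2 ^ n"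
    and net_finite: "\<And>n. finite (\<pi> n ` S)"
    and net_card: "\<And>n. real (card (\<pi> n ` S)) \<le> B * D ^ n"
    and net_measurable: "\<And>n. \<pi> n \<in> restrict_space borel S \<rightarrow>\<^sub>M restrict_space borel S"

text \<open>
The space is cut into half-open cubes of side \<open>1 / s n\<close>, and \<open>\<pi> n x\<close> is a chosen point of \<open>S\<close> in
the cube of \<open>x\<close>.  There are only finitely many cubes that meet \<open>S\<close>, and so \<open>\<pi> n\<close> factors through a
measurable function with finite range.  This makes \<open>\<pi> n\<close> measurable whatever representatives are
chosen.
\<close>

lemma bounded_imp_dyadic_nets:
  fixes S :: "'a::euclidean_space set"
  assumes "bounded S"
  obtains \<pi> R B D where "dyadic_nets S \<pi> R B D"
proof -
  obtain r where r: "r > 0" "\<And>x. x \<in> S \<Longrightarrow> norm x \<le> r"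
    using assms by (auto simp: bounded_pos)
  define d where "d = real DIM('a)"
  have d: "d \<ge> 1" using DIM_positive[where 'a='a] unfolding d_def by linarith
  define R where "R = 2 * r"
  \<comment> \<open>The factor \<open>d\<close> makes the \<open>l\<^sup>1\<close>-diameter of a cube at most \<open>R / 2 ^ n\<close>.\<close>
  define s where "s n = d * 2 ^ n / R" for n :: nat
  have s: "s n > 0" for n using d r(1) by (simp add: s_def R_def)
  define g where "g n x = (\<Sum>b\<in>Basis. real_of_int \<lfloor>s n * (x \<bullet> b)\<rfloor> *\<^sub>R b)" for n and x :: 'a
  define L where "L n = \<lceil>s n * r\<rceil>" for n
  define F where "F n = (Basis :: 'a set) \<rightarrow>\<^sub>E {- L n..L n}" for n :: nat
  have "finite (F n)" for n unfolding F_def by (intro finite_PiE) auto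
  have gF: "g n ` S \<subseteq> (\<lambda>f :: 'a \<Rightarrow> int. \<Sum>b\<in>Basis. real_of_int (f b) *\<^sub>R b) ` F n" for n
  proof
    fix z assume "z \<in> g n ` S"
    then obtain x where x: "x \<in> S" "z = g n x" by blast
    define f where "f = (\<lambda>b\<in>Basis. \<lfloor>s n * (x \<bullet> b)\<rfloor>)"
    have "\<lfloor>s n * (x \<bullet> b)\<rfloor> \<in> {- L n..L n}" if "b \<in> Basis" for b
    proof -
      have "\<bar>x \<bullet> b\<bar> \<le> r" using Basis_le_norm[OF that, of x] r(2)[OF x(1)] by simp
      then have "\<bar>s n * (x \<bullet> b)\<bar> \<le> s n * r" using s[of n] by (simp add: abs_mult)
      then show ?thesis unfolding L_def by simp linarith
    qed
    then have "f \<in> F n" by (auto simp: f_def F_def)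
    moreover have "z = (\<Sum>b\<in>Basis. real_of_int (f b) *\<^sub>R b)" by (simp add: x(2) g_def f_def)
    ultimately show "z \<in> (\<lambda>f :: 'a \<Rightarrow> int. \<Sum>b\<in>Basis. real_of_int (f b) *\<^sub>R b) ` F n" by blast
  qed
  have fin: "finite (g n ` S)" for n using finite_subset[OF gF] \<open>finite (F n)\<close> by blast
  have card: "real (card (g n ` S)) \<le> (d + 3) ^ DIM('a) * (2 ^ DIM('a)) ^ n" for n
  proof -
    have "card (g n ` S) \<le> card (F n)"
      using surj_card_le[OF \<open>finite (F n)\<close> gF] .
    also have "card (F n) = (nat (2 * L n + 1)) ^ DIM('a)"
      unfolding F_def by (subst card_PiE) (auto simp: algebra_simps)
    finally have "real (card (g n ` S)) \<le> real (nat (2 * L n + 1)) ^ DIM('a)"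
      by (metis of_nat_le_iff of_nat_power)
    also have "\<dots> \<le> ((d + 3) * 2 ^ n) ^ DIM('a)"
    proof (rule power_mono)
      have "0 < s n * r" using s[of n] r(1) by simp
      then have "L n \<ge> 0" unfolding L_def by linarith
      then have "real (nat (2 * L n + 1)) = 2 * real_of_int (L n) + 1" by simp
      also have "\<dots> \<le> 2 * (s n * r + 1) + 1"
      proof -
        have "real_of_int (L n) \<le> s n * r + 1" unfolding L_def by (rule of_int_ceiling_le_add_one)
        then show ?thesis by (intro add_mono mult_left_mono) auto
      qed
      also have "\<dots> = d * 2 ^ n + 3" using r(1) by (simp add: s_def R_def)
      also have "\<dots> \<le> (d + 3) * 2 ^ n" by (simp add: algebra_simps)
      finally show "real (nat (2 * L n + 1)) \<le> (d + 3) * 2 ^ n" .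
    qed simp
    finally show ?thesis by (simp add: power_mult_distrib power_mult[symmetric] mult.commute)
  qed
  have gdist: "dist x y \<le> R / 2 ^ n" if "g n x = g n y" for n x y
  proof -
    have "\<bar>(x - y) \<bullet> b\<bar> \<le> 1 / s n" if b: "b \<in> Basis" for b
    proof -
      have "g n z \<bullet> b = real_of_int \<lfloor>s n * (z \<bullet> b)\<rfloor>" for z
        using b unfolding g_def by (simp add: inner_sum_left_Basis)
      then have "\<lfloor>s n * (x \<bullet> b)\<rfloor> = \<lfloor>s n * (y \<bullet> b)\<rfloor>" using \<open>g n x = g n y\<close> by (metis of_int_eq_iff)
      then have "\<bar>s n * (x \<bullet> b) - s n * (y \<bullet> b)\<bar> \<le> 1" by linarith
      then have "s n * \<bar>(x - y) \<bullet> b\<bar> \<le> 1"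
        using s[of n] by (simp add: inner_diff_left abs_mult flip: right_diff_distrib)
      then show ?thesis using s[of n] by (simp add: field_simps)
    qed
    then have "(\<Sum>b\<in>Basis. \<bar>(x - y) \<bullet> b\<bar>) \<le> of_nat (card (Basis :: 'a set)) * (1 / s n)"
      by (intro sum_bounded_above) auto
    also have "\<dots> = R / 2 ^ n" using d by (simp add: s_def flip: d_def)
    finally show ?thesis using norm_le_l1[of "x - y"] by (simp add: dist_norm)
  qed
  define rep where "rep n z = (SOME u. u \<in> S \<and> g n u = z)" for n z
  define \<pi> where "\<pi> n x = rep n (g n x)" for n x
  have \<pi>: "\<pi> n x \<in> S \<and> g n (\<pi> n x) = g n x" if "x \<in> S" for n x
    unfolding \<pi>_def rep_def by (rule someI[of _ x]) (use that in simp)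
  have im: "\<pi> n ` S = rep n ` (g n ` S)" for n by (auto simp: \<pi>_def)
  have "dyadic_nets S \<pi> R ((d + 3) ^ DIM('a)) (2 ^ DIM('a))"
  proof
    show "R > 0" "(2 :: real) ^ DIM('a) \<ge> 1" using r(1) by (simp_all add: R_def)
    show "dist x y \<le> R" if "x \<in> S" "y \<in> S" for x y
      using norm_triangle_ineq4[of x y] r(2)[OF that(1)] r(2)[OF that(2)]
      by (simp add: R_def dist_norm)
    show "\<pi> n x \<in> S" if "x \<in> S" for n x using \<pi>[OF that] by blast
    show "dist x (\<pi> n x) \<le> R / 2 ^ n" if "x \<in> S" for n x using \<pi>[OF that] gdist by metis
    show "finite (\<pi> n ` S)" for n unfolding im using fin by simp
    show "real (card (\<pi> n ` S)) \<le> (d + 3) ^ DIM('a) * (2 ^ DIM('a)) ^ n" for n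
      using card_image_le[OF fin[of n], of "rep n"] card[of n] unfolding im by linarith
    show "\<pi> n \<in> restrict_space borel S \<rightarrow>\<^sub>M restrict_space borel S" for n
    proof (rule measurable_restrict_space2)
      show "\<pi> n \<in> space (restrict_space borel S) \<rightarrow> S" using \<pi> by (simp add: space_restrict_space)
      have "g n \<in> borel_measurable borel" unfolding g_def by measurable
      then have "g n \<in> borel_measurable (restrict_space borel S)"
        by (rule measurable_restrict_space1)
      then have "simple_function (restrict_space borel S) (g n)"
        using fin[of n] by (intro simple_function_borel_measurable) (simp_all add: space_restrict_space)
      then have "simple_function (restrict_space borel S) (rep n \<circ> g n)"
        by (rule simple_function_compose)
      then show "\<pi> n \<in> borel_measurable (restrict_space borel S)"
        unfolding \<pi>_def comp_def by (rule borel_measurable_simple_function)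
    qed
  qed
  then show thesis by (rule that)
qed

context dyadic_nets
begin

text \<open>
The pairs of net points whose increments enter the chaining argument.  The radius is three times
the mesh so as to contain the approximations at level \<open>n\<close> of two points whose distance is at most
the mesh, as well as the successive approximations of a single point.
\<close>

definition near :: "nat \<Rightarrow> ('a \<times> 'a) set"
  where "near n = {(u, v) \<in> \<pi> n ` S \<times> (\<pi> n ` S \<union> \<pi> (Suc n) ` S). dist u v \<le> 3 * R / 2 ^ n}"

lemma near_subset: "near n \<subseteq> \<pi> n ` S \<times> (\<pi> n ` S \<union> \<pi> (Suc n) ` S)"
  by (auto simp: near_def)

lemma finite_near: "finite (near n)"
  by (rule finite_subset[OF near_subset]) (simp add: net_finite)

lemma card_near: "real (card (near n)) \<le> B\<^sup>2 * (1 + D) * (D\<^sup>2) ^ n"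
proof -
  have "card (near n) \<le> card (\<pi> n ` S \<times> (\<pi> n ` S \<union> \<pi> (Suc n) ` S))"
    by (intro card_mono near_subset) (simp add: net_finite)
  also have "\<dots> \<le> card (\<pi> n ` S) * (card (\<pi> n ` S) + card (\<pi> (Suc n) ` S))"
    unfolding card_cartesian_product by (intro mult_le_mono2 card_Un_le)
  finally have "real (card (near n))
      \<le> real (card (\<pi> n ` S)) * (real (card (\<pi> n ` S)) + real (card (\<pi> (Suc n) ` S)))"
    by (metis of_nat_add of_nat_le_iff of_nat_mult)
  also have "\<dots> \<le> (B * D ^ n) * (B * D ^ n + B * D ^ Suc n)"
    using net_card[of n] net_card[of "Suc n"] order_trans[OF of_nat_0_le_iff net_card[of n]]
    by (intro mult_mono add_mono) auto
  also have "\<dots> = B\<^sup>2 * (1 + D) * (D\<^sup>2) ^ n"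
    by (simp add: algebra_simps power2_eq_square power_mult_distrib)
  finally show ?thesis .
qed

lemma near_Suc:
  assumes "x \<in> S"
  shows "(\<pi> n x, \<pi> (Suc n) x) \<in> near n"
proof -
  have "dist (\<pi> n x) (\<pi> (Suc n) x) \<le> dist x (\<pi> n x) + dist x (\<pi> (Suc n) x)"
    by (rule dist_triangle3)
  also have "\<dots> \<le> R / 2 ^ n + R / 2 ^ Suc n" using assms by (intro add_mono net_dist)
  also have "\<dots> \<le> 3 * R / 2 ^ n" using R_pos by (simp add: field_simps)
  finally show ?thesis using assms by (auto simp: near_def)
qed

lemma near_same_level:
  assumes "x \<in> S" "y \<in> S" "dist x y \<le> R / 2 ^ n"
  shows "(\<pi> n x, \<pi> n y) \<in> near n"
proof -
  have "dist (\<pi> n x) (\<pi> n y) \<le> dist x (\<pi> n x) + (dist x y + dist y (\<pi> n y))"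
    by (metis add_left_mono dist_commute dist_triangle dist_triangle_le)
  also have "\<dots> \<le> R / 2 ^ n + (R / 2 ^ n + R / 2 ^ n)"
    using assms by (intro add_mono net_dist)
  finally show ?thesis using assms by (auto simp: near_def)
qed

lemma near_in: "(u, v) \<in> near n \<Longrightarrow> u \<in> S \<and> v \<in> S \<and> dist u v \<le> 3 * R / 2 ^ n"
  by (auto simp: near_def net_in)

text \<open>
The increments along \<open>\<pi> n x\<close>, \<open>\<pi> (n + 1) x\<close>, \<dots> are dominated by a geometric series.
\<close>

lemma chaining_tail:
  fixes f :: "'a \<Rightarrow> real"
  assumes q: "0 < q" "q < 1" and K: "K \<ge> 0"
    and f: "\<And>n u v. (u, v) \<in> near n \<Longrightarrow> \<bar>f u - f v\<bar> \<le> K * q ^ n" and x: "x \<in> S"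
  shows "convergent (\<lambda>n. f (\<pi> n x))"
    and "\<bar>lim (\<lambda>n. f (\<pi> n x)) - f (\<pi> n x)\<bar> \<le> K * q ^ n / (1 - q)"
proof -
  define a where "a n = f (\<pi> n x)" for n
  have step: "\<bar>a (Suc n) - a n\<bar> \<le> K * q ^ n" for n
    using f[OF near_Suc[OF x, of n]] unfolding a_def by linarith
  have sm: "summable (\<lambda>n. a (Suc n) - a n)"
  proof (rule summable_comparison_test')
    show "summable (\<lambda>n. K * q ^ n)" using q by (intro summable_mult summable_geometric) simp
    show "norm (a (Suc n) - a n) \<le> K * q ^ n" for n using step[of n] by (simp only: real_norm_def)
  qed
  have "(\<lambda>n. a n - a 0) \<longlonglongrightarrow> (\<Sum>n. a (Suc n) - a n)"
    using summable_LIMSEQ[OF sm] by (simp only: sum_lessThan_telescope)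
  then have "(\<lambda>n. a n - a 0 + a 0) \<longlonglongrightarrow> (\<Sum>n. a (Suc n) - a n) + a 0"
    by (intro tendsto_add tendsto_const)
  then show conv: "convergent (\<lambda>n. f (\<pi> n x))"
    by (simp add: convergentI a_def)
  have part: "\<bar>a (n + k) - a n\<bar> \<le> K * q ^ n * (1 - q ^ k) / (1 - q)" for k
  proof (induction k)
    case (Suc k)
    have "\<bar>a (n + Suc k) - a n\<bar> \<le> K * q ^ (n + k) + K * q ^ n * (1 - q ^ k) / (1 - q)"
      using step[of "n + k"] Suc by simp
    also have "K * q ^ (n + k) = K * q ^ n * (q ^ k * (1 - q)) / (1 - q)"
      using q by (simp add: power_add)
    also have "\<dots> + K * q ^ n * (1 - q ^ k) / (1 - q) = K * q ^ n * (1 - q ^ Suc k) / (1 - q)"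
      unfolding add_divide_distrib[symmetric] distrib_left[symmetric] by (simp add: algebra_simps)
    finally show ?case .
  qed simp
  have "\<bar>a (k + n) - a n\<bar> \<le> K * q ^ n / (1 - q)" for k
  proof -
    have "K * q ^ n * (1 - q ^ k) \<le> K * q ^ n * 1"
      using q K by (intro mult_left_mono) auto
    then have "K * q ^ n * (1 - q ^ k) / (1 - q) \<le> K * q ^ n / (1 - q)"
      using q by (intro divide_right_mono) auto
    then show ?thesis using part[of k] by (simp add: add.commute)
  qed
  moreover have "(\<lambda>k. \<bar>a (k + n) - a n\<bar>) \<longlonglongrightarrow> \<bar>lim a - a n\<bar>"
    using conv unfolding a_def[symmetric] convergent_LIMSEQ_iff
    by (intro tendsto_intros LIMSEQ_ignore_initial_segment)
  ultimately show "\<bar>lim (\<lambda>n. f (\<pi> n x)) - f (\<pi> n x)\<bar> \<le> K * q ^ n / (1 - q)"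
    unfolding a_def[symmetric] by (intro LIMSEQ_le_const2) auto
qed

text \<open>
For two points at distance about \<open>R / 2 ^ n\<close>, the limits are compared through the
approximations at level \<open>n\<close>: the two tails and the increment between the approximations
are all \<open>O (2 powr (- \<gamma> n))\<close>.
\<close>

lemma chaining_hoelder:
  fixes f :: "'a \<Rightarrow> real"
  assumes \<gamma>: "\<gamma> > 0" and K: "K \<ge> 0"
    and f: "\<And>n u v. (u, v) \<in> near n \<Longrightarrow> \<bar>f u - f v\<bar> \<le> K * (2 powr - \<gamma>) ^ n"
  shows "\<exists>C. \<forall>x\<in>S. \<forall>y\<in>S. \<bar>lim (\<lambda>n. f (\<pi> n x)) - lim (\<lambda>n. f (\<pi> n y))\<bar> \<le> C * dist x y powr \<gamma>"
proof -
  define q where "q = 2 powr - \<gamma>"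
  have q: "0 < q" "q < 1" using \<gamma> by (auto simp: q_def powr_less_one)
  define g where "g x = lim (\<lambda>n. f (\<pi> n x))" for x
  define E where "E = 2 * (K / (1 - q)) + K"
  have E: "E \<ge> 0" using K q by (simp add: E_def)
  have "\<bar>g x - g y\<bar> \<le> (E * (2 / R) powr \<gamma>) * dist x y powr \<gamma>" if xy: "x \<in> S" "y \<in> S" for x y
  proof (cases "x = y")
    case False
    define \<delta> where "\<delta> = dist x y"
    have \<delta>: "0 < \<delta>" "\<delta> \<le> R" using False dist_le_R[OF xy] by (auto simp: \<delta>_def)
    \<comment> \<open>The level \<open>n\<close> with \<open>R / 2 ^ (n + 1) < \<delta> \<le> R / 2 ^ n\<close> is found as a switch of \<open>P\<close>.\<close>
    define P where "P n \<longleftrightarrow> R / 2 ^ n < \<delta>" for n :: nat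
    have "\<exists>n. P n"
    proof -
      obtain n where "(1 / 2) ^ n < \<delta> / R"
        using real_arch_pow_inv[of "\<delta> / R" "1 / 2"] \<delta> R_pos by auto
      then show ?thesis using R_pos by (auto simp: P_def field_simps power_divide intro!: exI[of _ n])
    qed
    moreover have "\<not> P 0" using \<delta> by (simp add: P_def)
    ultimately obtain n where n: "\<not> P n" "P (Suc n)"
      using ex_least_nat_less[of P] by blast
    have "\<bar>f (\<pi> n x) - f (\<pi> n y)\<bar> \<le> K * q ^ n"
      using f near_same_level[OF xy, of n] n(1) unfolding q_def by (simp add: P_def \<delta>_def not_less)
    moreover have "\<bar>g z - f (\<pi> n z)\<bar> \<le> K * q ^ n / (1 - q)" if "z \<in> S" for z
      unfolding g_def using chaining_tail(2)[OF q K _ that] f by (simp add: q_def)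
    note this[OF xy(1)] this[OF xy(2)]
    ultimately have "\<bar>g x - g y\<bar> \<le> K * q ^ n / (1 - q) + K * q ^ n / (1 - q) + K * q ^ n"
      by linarith
    also have "\<dots> = E * q ^ n" by (simp add: E_def algebra_simps)
    also have "q ^ n = (1 / 2 ^ n) powr \<gamma>"
      by (simp add: q_def powr_power powr_divide powr_minus_divide powr_powr mult.commute flip: powr_realpow)
    also have "E * (1 / 2 ^ n) powr \<gamma> \<le> E * (2 / R * \<delta>) powr \<gamma>"
      using n(2) R_pos \<gamma> E by (intro mult_left_mono powr_mono2) (auto simp: P_def field_simps)
    also have "\<dots> = (E * (2 / R) powr \<gamma>) * \<delta> powr \<gamma>"
      using R_pos \<delta> by (simp only: powr_mult mult.assoc)
    finally show ?thesis by (simp add: \<delta>_def)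
  qed simp
  then show ?thesis unfolding g_def by blast
qed

end

text \<open>
This takes the place of the Borel-Cantelli lemma together with Markov's inequality.
\<close>

lemma AE_summable_if_summable_integrals:
  fixes X :: "nat \<Rightarrow> 'a \<Rightarrow> real"
  assumes [measurable]: "\<And>n. X n \<in> borel_measurable M"
    and X: "\<And>n \<omega>. X n \<omega> \<ge> 0"
    and le: "\<And>n. (\<integral>\<^sup>+\<omega>. ennreal (X n \<omega>) \<partial>M) \<le> ennreal (c n)"
    and c: "summable c" "\<And>n. c n \<ge> 0"
  shows "AE \<omega> in M. summable (\<lambda>n. X n \<omega>)"
proof -
  have "(\<integral>\<^sup>+\<omega>. (\<Sum>n. ennreal (X n \<omega>)) \<partial>M) = (\<Sum>n. \<integral>\<^sup>+\<omega>. ennreal (X n \<omega>) \<partial>M)"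
    by (rule nn_integral_suminf) simp
  also have "\<dots> \<le> (\<Sum>n. ennreal (c n))" by (intro suminf_le le) auto
  also have "\<dots> < top" using ennreal_suminf_neq_top[OF c] by (simp add: less_top)
  finally have "AE \<omega> in M. (\<Sum>n. ennreal (X n \<omega>)) \<noteq> \<infinity>"
    by (intro nn_integral_PInf_AE) auto
  then show ?thesis by eventually_elim (use X in \<open>auto intro: summable_suminf_not_top\<close>)
qed

text \<open>
Let \<open>X n\<close> be the sum of \<open>(2 powr (\<gamma> n) \<bar>T u - T v\<bar>) ^ (2 k)\<close> over all pairs of \<open>near n\<close>.
There are at most a constant times \<open>(D\<^sup>2) ^ n\<close> pairs, and each contributes
\<open>O (2 powr (- 2 k (\<alpha> - \<gamma>) n))\<close> to the expectation.  For large \<open>k\<close> the second factor wins, the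
expectations are summable, and \<open>X n\<close> is almost surely bounded in \<open>n\<close>.
\<close>

lemma (in dyadic_nets) AE_chaining_bound:
  fixes T :: "'w \<Rightarrow> 'a \<Rightarrow> real"
  assumes meas: "\<And>x. x \<in> S \<Longrightarrow> (\<lambda>\<omega>. T \<omega> x) \<in> borel_measurable M"
    and moment: "\<And>k. k > 0 \<Longrightarrow> \<exists>C. \<forall>x\<in>S. \<forall>y\<in>S.
      (\<integral>\<^sup>+\<omega>. ennreal ((T \<omega> x - T \<omega> y) ^ (2 * k)) \<partial>M) \<le> ennreal (C * dist x y powr (real (2 * k) * \<alpha>))"
    and \<gamma>: "\<gamma> < \<alpha>"
    and \<alpha>: "\<alpha> > 0"
  shows "AE \<omega> in M. \<exists>K\<ge>0. \<forall>n u v. (u, v) \<in> near n \<longrightarrow> \<bar>T \<omega> u - T \<omega> v\<bar> \<le> K * (2 powr - \<gamma>) ^ n"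
proof -
  define \<rho> :: real where "\<rho> = 2 powr (- 2 * (\<alpha> - \<gamma>))"
  have \<rho>: "0 < \<rho>" "\<rho> < 1" using \<gamma> by (auto simp: \<rho>_def powr_less_one)
  \<comment> \<open>The only place where moments of high order are needed: \<open>k\<close> has to beat the size of the nets.\<close>
  obtain k where k: "\<rho> ^ k < 1 / D\<^sup>2"
    using real_arch_pow_inv[of "1 / D\<^sup>2" \<rho>] \<rho> D_ge_1 by auto
  have k0: "k > 0"
  proof (rule ccontr)
    assume "\<not> k > 0"
    with k have "1 < 1 / D\<^sup>2" by simp
    moreover have "1 / D\<^sup>2 \<le> 1" using D_ge_1 by simp
    ultimately show False by linarith
  qed
  obtain C0 where C0: "\<And>x y. x \<in> S \<Longrightarrow> y \<in> S \<Longrightarrow>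
      (\<integral>\<^sup>+\<omega>. ennreal ((T \<omega> x - T \<omega> y) ^ (2 * k)) \<partial>M) \<le> ennreal (C0 * dist x y powr (real (2 * k) * \<alpha>))"
    using moment[OF k0] by blast
  define C where "C = \<bar>C0\<bar>"
  define w :: real where "w = 2 powr \<gamma>"
  have w: "w > 0" by (simp add: w_def)
  define X where "X n \<omega> = (\<Sum>(u, v)\<in>near n. (w ^ n * (T \<omega> u - T \<omega> v)) ^ (2 * k))" for n \<omega>
  define H where "H = B\<^sup>2 * (1 + D) * (C * (3 * R) powr (real (2 * k) * \<alpha>))"
  define \<theta> where "\<theta> = D\<^sup>2 * \<rho> ^ k"
  have \<theta>: "0 \<le> \<theta>" "\<theta> < 1" using k D_ge_1 \<rho> by (auto simp: \<theta>_def field_simps)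
  have "AE \<omega> in M. summable (\<lambda>n. X n \<omega>)"
  proof (rule AE_summable_if_summable_integrals)
    show "X n \<in> borel_measurable M" for n
      unfolding X_def split_def
      by (intro borel_measurable_sum borel_measurable_power borel_measurable_times borel_measurable_diff
          borel_measurable_const meas) (use near_in in force)+
    show "X n \<omega> \<ge> 0" for n \<omega>
      unfolding X_def by (intro sum_nonneg) (auto simp: zero_le_even_power)
    show "summable (\<lambda>n. H * \<theta> ^ n)" using \<theta> by (intro summable_mult summable_geometric) auto
    show "H * \<theta> ^ n \<ge> 0" for n
      using \<theta> D_ge_1 by (auto simp: H_def C_def intro!: mult_nonneg_nonneg)
    show "(\<integral>\<^sup>+\<omega>. ennreal (X n \<omega>) \<partial>M) \<le> ennreal (H * \<theta> ^ n)" for n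
    proof -
      define c where "c = (w ^ n) ^ (2 * k) * (C * (3 * R / 2 ^ n) powr (real (2 * k) * \<alpha>))"
      have c: "c \<ge> 0" using w by (simp add: c_def C_def)
      have pair: "(\<integral>\<^sup>+\<omega>. ennreal ((w ^ n * (T \<omega> u - T \<omega> v)) ^ (2 * k)) \<partial>M) \<le> ennreal c"
        if "(u, v) \<in> near n" for u v
      proof -
        have uv: "u \<in> S" "v \<in> S" "dist u v \<le> 3 * R / 2 ^ n" using near_in[OF that] by auto
        have [measurable]: "(\<lambda>\<omega>. T \<omega> u) \<in> borel_measurable M" "(\<lambda>\<omega>. T \<omega> v) \<in> borel_measurable M"
          using meas uv by auto
        have "(\<integral>\<^sup>+\<omega>. ennreal ((w ^ n * (T \<omega> u - T \<omega> v)) ^ (2 * k)) \<partial>M)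
            = (\<integral>\<^sup>+\<omega>. ennreal ((w ^ n) ^ (2 * k)) * ennreal ((T \<omega> u - T \<omega> v) ^ (2 * k)) \<partial>M)"
          using w by (intro nn_integral_cong) (simp add: power_mult_distrib flip: ennreal_mult)
        also have "\<dots> = ennreal ((w ^ n) ^ (2 * k)) * (\<integral>\<^sup>+\<omega>. ennreal ((T \<omega> u - T \<omega> v) ^ (2 * k)) \<partial>M)"
          by (intro nn_integral_cmult) measurable
        also have "\<dots> \<le> ennreal ((w ^ n) ^ (2 * k)) * ennreal (C * (3 * R / 2 ^ n) powr (real (2 * k) * \<alpha>))"
        proof (rule mult_left_mono)
          have "C0 * dist u v powr (real (2 * k) * \<alpha>) \<le> C * (3 * R / 2 ^ n) powr (real (2 * k) * \<alpha>)"
            using uv(3) \<alpha> by (intro mult_mono powr_mono2) (auto simp: C_def)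
          then show "(\<integral>\<^sup>+\<omega>. ennreal ((T \<omega> u - T \<omega> v) ^ (2 * k)) \<partial>M)
              \<le> ennreal (C * (3 * R / 2 ^ n) powr (real (2 * k) * \<alpha>))"
            using C0[OF uv(1,2)] ennreal_leI order_trans by blast
        qed simp
        also have "\<dots> = ennreal c" using w by (simp add: c_def C_def flip: ennreal_mult)
        finally show ?thesis .
      qed
      have "(\<integral>\<^sup>+\<omega>. ennreal (X n \<omega>) \<partial>M)
          = (\<integral>\<^sup>+\<omega>. (\<Sum>p\<in>near n. ennreal ((w ^ n * (T \<omega> (fst p) - T \<omega> (snd p))) ^ (2 * k))) \<partial>M)"
        unfolding X_def split_def by (intro nn_integral_cong) (simp add: zero_le_even_power)
      also have "\<dots> = (\<Sum>p\<in>near n. \<integral>\<^sup>+\<omega>. ennreal ((w ^ n * (T \<omega> (fst p) - T \<omega> (snd p))) ^ (2 * k)) \<partial>M)"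
      proof (rule nn_integral_sum)
        fix p assume "p \<in> near n"
        then have [measurable]: "(\<lambda>\<omega>. T \<omega> (fst p)) \<in> borel_measurable M" "(\<lambda>\<omega>. T \<omega> (snd p)) \<in> borel_measurable M"
          using meas near_in[of "fst p" "snd p" n] by auto
        show "(\<lambda>\<omega>. ennreal ((w ^ n * (T \<omega> (fst p) - T \<omega> (snd p))) ^ (2 * k))) \<in> borel_measurable M"
          by measurable
      qed
      also have "\<dots> \<le> of_nat (card (near n)) * ennreal c"
        by (intro sum_bounded_above) (use pair in auto)
      also have "\<dots> = ennreal (real (card (near n)) * c)"
        using c by (simp add: ennreal_of_nat_eq_real_of_nat ennreal_mult)
      also have "real (card (near n)) * c \<le> B\<^sup>2 * (1 + D) * (D\<^sup>2) ^ n * c"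
        by (intro mult_right_mono card_near c)
      also have "\<dots> = H * \<theta> ^ n"
      proof -
        have "(w ^ n) ^ (2 * k) * (1 / 2 ^ n) powr (real (2 * k) * \<alpha>) = (\<rho> ^ k) ^ n"
        proof -
          have "(w ^ n) ^ (2 * k) = 2 powr (real n * (real (2 * k) * \<gamma>))"
            unfolding w_def power_mult[symmetric] by (simp add: powr_powr mult_ac flip: powr_realpow)
          moreover have "(1 / 2 ^ n) powr (real (2 * k) * \<alpha>) = 2 powr (- (real n * (real (2 * k) * \<alpha>)))"
            by (simp add: powr_divide powr_powr powr_minus_divide flip: powr_realpow)
          moreover have "(\<rho> ^ k) ^ n = 2 powr (real n * (real (2 * k) * (\<gamma> - \<alpha>)))"
            unfolding \<rho>_def power_mult[symmetric]
            by (simp add: powr_powr algebra_simps flip: powr_realpow)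
          ultimately show ?thesis by (simp add: algebra_simps flip: powr_add)
        qed
        moreover have "(3 * R / 2 ^ n) powr (real (2 * k) * \<alpha>)
            = (3 * R) powr (real (2 * k) * \<alpha>) * (1 / 2 ^ n) powr (real (2 * k) * \<alpha>)"
          using R_pos by (simp flip: powr_mult)
        ultimately show ?thesis
          by (simp add: H_def \<theta>_def c_def power_mult_distrib mult_ac)
      qed
      finally show ?thesis by (simp add: ennreal_leI)
    qed
  qed
  then show ?thesis
  proof eventually_elim
    case (elim \<omega>)
    then obtain L where L: "L > 0" "\<And>n. norm (X n \<omega>) \<le> L"
      using summable_LIMSEQ_zero[THEN convergentI, THEN convergent_imp_Bseq] by (metis BseqE)
    have "\<bar>T \<omega> u - T \<omega> v\<bar> \<le> (L + 1) * (2 powr - \<gamma>) ^ n" if uv: "(u, v) \<in> near n" for n u v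
    proof -
      define a where "a = w ^ n * (T \<omega> u - T \<omega> v)"
      have "a ^ (2 * k) \<le> X n \<omega>"
        unfolding X_def a_def
        using member_le_sum[OF uv, of "\<lambda>(u, v). (w ^ n * (T \<omega> u - T \<omega> v)) ^ (2 * k)"]
        by (auto simp: finite_near zero_le_even_power)
      \<comment> \<open>\<open>L + 1\<close> rather than \<open>L\<close>, as only numbers \<open>\<ge> 1\<close> are below their powers.\<close>
      also have "\<dots> \<le> L + 1" using L(2)[of n] by simp
      also have "\<dots> \<le> (L + 1) ^ (2 * k)" using L(1) k0 by (intro self_le_power) auto
      finally have "\<bar>a\<bar> ^ (2 * k) \<le> (L + 1) ^ (2 * k)" by (simp add: power_even_abs)
      then have "\<bar>a\<bar> \<le> L + 1" using L(1) k0 by (subst (asm) power_mono_iff) auto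
      moreover have "\<bar>a\<bar> = w ^ n * \<bar>T \<omega> u - T \<omega> v\<bar>" using w by (simp add: a_def abs_mult)
      ultimately have "w ^ n * \<bar>T \<omega> u - T \<omega> v\<bar> \<le> L + 1" by simp
      then have "\<bar>T \<omega> u - T \<omega> v\<bar> \<le> (L + 1) * (1 / w) ^ n"
        using w by (simp add: power_divide field_simps)
      then show ?thesis by (simp add: w_def powr_minus_divide)
    qed
    then show ?case using L(1) by (intro exI[of _ "L + 1"]) auto
  qed
qed

text \<open>
The second moments of \<open>T (\<pi> n x) - T x\<close> decay geometrically.  This identifies the limit along
the nets with \<open>T x\<close>, for each fixed \<open>x\<close> almost surely.
\<close>

lemma (in dyadic_nets) AE_tendsto_along_nets:
  fixes T :: "'w \<Rightarrow> 'a \<Rightarrow> real"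
  assumes meas: "\<And>x. x \<in> S \<Longrightarrow> (\<lambda>\<omega>. T \<omega> x) \<in> borel_measurable M"
    and moment: "\<And>x y. x \<in> S \<Longrightarrow> y \<in> S \<Longrightarrow>
      (\<integral>\<^sup>+\<omega>. ennreal ((T \<omega> x - T \<omega> y)\<^sup>2) \<partial>M) \<le> ennreal (C * dist x y powr (2 * \<alpha>))"
    and \<alpha>: "\<alpha> > 0" and x: "x \<in> S"
  shows "AE \<omega> in M. (\<lambda>n. T \<omega> (\<pi> n x)) \<longlonglongrightarrow> T \<omega> x"
proof -
  have [measurable]: "(\<lambda>\<omega>. T \<omega> x) \<in> borel_measurable M" "(\<lambda>\<omega>. T \<omega> (\<pi> n x)) \<in> borel_measurable M" for n
    using meas x net_in by auto
  define q :: real where "q = 2 powr (- 2 * \<alpha>)"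
  have q: "0 < q" "q < 1" using \<alpha> by (auto simp: q_def powr_less_one)
  have "AE \<omega> in M. summable (\<lambda>n. (T \<omega> x - T \<omega> (\<pi> n x))\<^sup>2)"
  proof (rule AE_summable_if_summable_integrals)
    show "summable (\<lambda>n. \<bar>C\<bar> * R powr (2 * \<alpha>) * q ^ n)"
      using q by (intro summable_mult summable_geometric) auto
    show "(\<integral>\<^sup>+\<omega>. ennreal ((T \<omega> x - T \<omega> (\<pi> n x))\<^sup>2) \<partial>M) \<le> ennreal (\<bar>C\<bar> * R powr (2 * \<alpha>) * q ^ n)" for n
    proof -
      have "C * dist x (\<pi> n x) powr (2 * \<alpha>) \<le> \<bar>C\<bar> * (R / 2 ^ n) powr (2 * \<alpha>)"
        using net_dist[OF x, of n] \<alpha> by (intro mult_mono powr_mono2) auto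
      also have "(R / 2 ^ n) powr (2 * \<alpha>) = R powr (2 * \<alpha>) * q ^ n"
        using R_pos by (simp add: q_def powr_divide powr_powr powr_minus_divide power_divide mult_ac flip: powr_realpow)
      finally show ?thesis
        using moment[OF x net_in[OF x], of n] ennreal_leI order_trans by (simp add: mult.assoc) blast
    qed
  qed (use q in auto)
  then show ?thesis
  proof eventually_elim
    case (elim \<omega>)
    then have "(\<lambda>n. sqrt ((T \<omega> x - T \<omega> (\<pi> n x))\<^sup>2)) \<longlonglongrightarrow> sqrt 0"
      by (intro tendsto_real_sqrt summable_LIMSEQ_zero)
    then have "(\<lambda>n. T \<omega> x - T \<omega> (\<pi> n x)) \<longlonglongrightarrow> 0"
      by (simp add: tendsto_rabs_zero_iff)
    then have "(\<lambda>n. T \<omega> x - (T \<omega> x - T \<omega> (\<pi> n x))) \<longlonglongrightarrow> T \<omega> x - 0"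
      by (intro tendsto_diff tendsto_const)
    then show ?case by simp
  qed
qed

lemma jointly_measurable_section:
  assumes T: "(\<lambda>(\<omega>, x). T \<omega> x) \<in> borel_measurable (M \<Otimes>\<^sub>M restrict_space borel S)" and x: "x \<in> S"
  shows "(\<lambda>\<omega>. T \<omega> x) \<in> borel_measurable M"
proof -
  have "(\<lambda>\<omega>. (\<omega>, x)) \<in> M \<rightarrow>\<^sub>M M \<Otimes>\<^sub>M restrict_space borel S"
    using x by (intro measurable_Pair2') (simp add: space_restrict_space)
  from measurable_compose[OF this T] show ?thesis by simp
qed

text \<open>
Since moments of all orders are assumed, no condition links \<open>\<alpha>\<close> to the dimension, and all
exponents below \<open>\<alpha>\<close> are attained.  The regularity holds for every \<open>\<omega>\<close>, since \<open>T'\<close> is \<open>0\<close> off the set \<open>G\<close>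
of full measure on which the chaining bounds hold; \<open>T'\<close> is jointly measurable as a pointwise limit
of the fields \<open>T \<omega> (\<pi> n x)\<close>.
\<close>

theorem kolmogorov_chentsov_all_moments:
  fixes T :: "'w \<Rightarrow> 'a::euclidean_space \<Rightarrow> real"
  assumes S: "bounded S"
    and T: "(\<lambda>(\<omega>, x). T \<omega> x) \<in> borel_measurable (M \<Otimes>\<^sub>M restrict_space borel S)"
    and \<alpha>: "\<alpha> > 0"
    and moment: "\<And>k. k > 0 \<Longrightarrow> \<exists>C. \<forall>x\<in>S. \<forall>y\<in>S.
      (\<integral>\<^sup>+\<omega>. ennreal ((T \<omega> x - T \<omega> y) ^ (2 * k)) \<partial>M) \<le> ennreal (C * dist x y powr (real (2 * k) * \<alpha>))"
  shows "\<exists>T'. (\<lambda>(\<omega>, x). T' \<omega> x) \<in> borel_measurable (M \<Otimes>\<^sub>M restrict_space borel S) \<and>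
    (\<forall>x\<in>S. AE \<omega> in M. T' \<omega> x = T \<omega> x) \<and>
    (\<forall>\<omega> \<gamma>. 0 < \<gamma> \<and> \<gamma> < \<alpha> \<longrightarrow> (\<exists>C. \<forall>x\<in>S. \<forall>y\<in>S. \<bar>T' \<omega> x - T' \<omega> y\<bar> \<le> C * dist x y powr \<gamma>))"
proof -
  obtain \<pi> R B D where "dyadic_nets S \<pi> R B D" using bounded_imp_dyadic_nets[OF S] .
  then interpret dyadic_nets S \<pi> R B D .
  note [measurable] = T net_measurable
  note meas = jointly_measurable_section[OF T]
  define good where "good \<omega> \<gamma> \<longleftrightarrow>
    (\<exists>K\<ge>0. \<forall>n u v. (u, v) \<in> near n \<longrightarrow> \<bar>T \<omega> u - T \<omega> v\<bar> \<le> K * (2 powr - \<gamma>) ^ n)" for \<omega> \<gamma>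
  \<comment> \<open>Rational exponents keep the union of the exceptional null sets countable.\<close>
  have "AE \<omega> in M. \<forall>\<gamma>\<in>{\<gamma>\<in>\<rat>. 0 < \<gamma> \<and> \<gamma> < \<alpha>}. good \<omega> \<gamma>"
    unfolding good_def
    by (intro AE_ball_countable' AE_chaining_bound[of T M \<alpha>] meas moment \<alpha>)
      (auto intro: countable_subset[OF _ countable_rat])
  then obtain N where N: "N \<in> null_sets M"
      "\<And>\<omega>. \<omega> \<in> space M - N \<Longrightarrow> \<forall>\<gamma>\<in>{\<gamma>\<in>\<rat>. 0 < \<gamma> \<and> \<gamma> < \<alpha>}. good \<omega> \<gamma>"
    by (rule AE_E3) blast
  define G where "G = space M - N"
  have G[measurable]: "G \<in> sets M" using N(1) by (auto simp: G_def)
  define T' where "T' \<omega> x = (if \<omega> \<in> G then lim (\<lambda>n. T \<omega> (\<pi> n x)) else 0)" for \<omega> x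
  have "(\<lambda>(\<omega>, x). T' \<omega> x) \<in> borel_measurable (M \<Otimes>\<^sub>M restrict_space borel S)"
  proof -
    have [measurable]: "(\<lambda>p. T (fst p) (\<pi> n (snd p))) \<in> borel_measurable (M \<Otimes>\<^sub>M restrict_space borel S)" for n
    proof -
      have "(\<lambda>p. (fst p, \<pi> n (snd p)))
          \<in> M \<Otimes>\<^sub>M restrict_space borel S \<rightarrow>\<^sub>M M \<Otimes>\<^sub>M restrict_space borel S"
        by measurable
      from measurable_compose[OF this T] show ?thesis by simp
    qed
    show ?thesis unfolding T'_def split_def by measurable
  qed
  moreover have "AE \<omega> in M. T' \<omega> x = T \<omega> x" if x: "x \<in> S" for x
  proof -
    obtain C where "\<And>x y. x \<in> S \<Longrightarrow> y \<in> S \<Longrightarrow>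
        (\<integral>\<^sup>+\<omega>. ennreal ((T \<omega> x - T \<omega> y)\<^sup>2) \<partial>M) \<le> ennreal (C * dist x y powr (2 * \<alpha>))"
      using moment[of 1] by auto
    then have "AE \<omega> in M. (\<lambda>n. T \<omega> (\<pi> n x)) \<longlonglongrightarrow> T \<omega> x"
      using AE_tendsto_along_nets[of T M C \<alpha>] meas \<alpha> x by blast
    moreover have "AE \<omega> in M. \<omega> \<in> G"
      using AE_not_in[OF N(1)] AE_space by eventually_elim (simp add: G_def)
    ultimately show ?thesis by eventually_elim (simp add: T'_def limI)
  qed
  moreover have "\<exists>C. \<forall>x\<in>S. \<forall>y\<in>S. \<bar>T' \<omega> x - T' \<omega> y\<bar> \<le> C * dist x y powr \<gamma>"
    if \<gamma>: "0 < \<gamma>" "\<gamma> < \<alpha>" for \<omega> \<gamma>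
  proof (cases "\<omega> \<in> G")
    case True
    obtain \<eta> where \<eta>: "\<eta> \<in> \<rat>" "\<gamma> < \<eta>" "\<eta> < \<alpha>" using Rats_dense_in_real[OF \<gamma>(2)] by blast
    then have "good \<omega> \<eta>" using N(2) True \<gamma>(1) by (auto simp: G_def)
    then obtain K where K: "K \<ge> 0"
        "\<And>n u v. (u, v) \<in> near n \<Longrightarrow> \<bar>T \<omega> u - T \<omega> v\<bar> \<le> K * (2 powr - \<eta>) ^ n"
      unfolding good_def by blast
    have "\<bar>T \<omega> u - T \<omega> v\<bar> \<le> K * (2 powr - \<gamma>) ^ n" if "(u, v) \<in> near n" for n u v
    proof -
      have "(2 powr - \<eta>) ^ n \<le> (2 powr - \<gamma> :: real) ^ n"
        using \<eta>(2) by (intro power_mono powr_mono) auto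
      then show ?thesis using K(2)[OF that] K(1) mult_left_mono order_trans by blast
    qed
    from chaining_hoelder[OF \<gamma>(1) K(1) this] show ?thesis using True by (simp add: T'_def)
  next
    case False
    then show ?thesis by (auto simp: T'_def intro!: exI[of _ 0])
  qed
  ultimately show ?thesis by blast
qed

section \<open>Hoelder continuity in the geodesic metric\<close>

text \<open>
A chord is at most as long as its arc: \<open>1 - cos t = 2 (sin (t / 2))\<^sup>2 \<le> t\<^sup>2 / 2\<close>.
\<close>

lemma dist_le_geodist:
  assumes "x \<in> sphere2" "y \<in> sphere2"
  shows "dist x y \<le> geodist x y"
proof -
  have n: "norm x = 1" "norm y = 1" using assms by auto
  define t where "t = geodist x y"
  have t: "t \<ge> 0" "cos t = x \<bullet> y"
    using abs_inner_sphere_le_1[OF n] unfolding t_def geodist_def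
    by (auto intro: arccos_lbound cos_arccos_abs)
  have "(dist x y)\<^sup>2 / 2 = 1 - cos t" using one_minus_inner_sphere[OF n] t by simp
  also have "\<dots> = 2 * (sin (t / 2))\<^sup>2" using cos_double_sin[of "t / 2"] by simp
  finally have "(dist x y)\<^sup>2 = 4 * (sin (t / 2))\<^sup>2" by simp
  moreover have "(sin (t / 2))\<^sup>2 \<le> (t / 2)\<^sup>2"
    using abs_sin_x_le_abs_x[of "t / 2"] unfolding abs_le_square_iff .
  ultimately have "(dist x y)\<^sup>2 \<le> t\<^sup>2" by (simp add: power_divide)
  then show ?thesis using t(1) unfolding t_def by (rule power2_le_imp_le)
qed

lemma dist_hoelder_imp_geo_hoelder:
  assumes "\<gamma> \<ge> 0"
    and f: "\<And>x y. x \<in> sphere2 \<Longrightarrow> y \<in> sphere2 \<Longrightarrow> \<bar>f x - f y\<bar> \<le> C * dist x y powr \<gamma>"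
  shows "geo_hoelder_continuous \<gamma> f"
proof -
  have "\<bar>f x - f y\<bar> \<le> \<bar>C\<bar> * geodist x y powr \<gamma>" if xy: "x \<in> sphere2" "y \<in> sphere2" for x y
  proof -
    have "C * dist x y powr \<gamma> \<le> \<bar>C\<bar> * geodist x y powr \<gamma>"
      using dist_le_geodist[OF xy] assms(1) by (intro mult_mono powr_mono2) auto
    with f[OF xy] show ?thesis by linarith
  qed
  then show ?thesis unfolding geo_hoelder_continuous_def by blast
qed

lemma geo_hoelder_imp_geo_continuous:
  assumes \<gamma>: "\<gamma> > 0" and f: "geo_hoelder_continuous \<gamma> f"
  shows "geo_continuous f"
  unfolding geo_continuous_def
proof (intro ballI allI impI)
  fix x :: "real^3" and \<epsilon> :: real
  assume x: "x \<in> sphere2" and \<epsilon>: "\<epsilon> > 0"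
  obtain C where C: "\<And>x y. x \<in> sphere2 \<Longrightarrow> y \<in> sphere2 \<Longrightarrow> \<bar>f x - f y\<bar> \<le> C * geodist x y powr \<gamma>"
    using f unfolding geo_hoelder_continuous_def by blast
  define E where "E = \<bar>C\<bar> + 1"
  have E: "E > 0" "C \<le> E" by (auto simp: E_def)
  define \<delta> where "\<delta> = (\<epsilon> / E) powr (1 / \<gamma>)"
  have "\<delta> > 0" using \<epsilon> E by (simp add: \<delta>_def)
  moreover have "\<bar>f x - f y\<bar> < \<epsilon>" if y: "y \<in> sphere2" and lt: "geodist x y < \<delta>" for y
  proof -
    have "0 \<le> geodist x y" using dist_le_geodist[OF x y] zero_le_dist[of x y] by linarith
    then have "geodist x y powr \<gamma> < \<delta> powr \<gamma>" using lt \<gamma> by (intro powr_less_mono2)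
    also have "\<delta> powr \<gamma> = \<epsilon> / E" using \<epsilon> E \<gamma> by (simp add: \<delta>_def powr_powr)
    finally have "E * geodist x y powr \<gamma> < \<epsilon>" using E by (simp add: field_simps)
    moreover have "C * geodist x y powr \<gamma> \<le> E * geodist x y powr \<gamma>"
      using E by (intro mult_right_mono) auto
    ultimately show ?thesis using C[OF x y] by linarith
  qed
  ultimately show "\<exists>\<delta>>0. \<forall>y\<in>sphere2. geodist x y < \<delta> \<longrightarrow> \<bar>f x - f y\<bar> < \<epsilon>" by blast
qed

lemma AE_eq_imp_modification:
  assumes M: "prob_space M" and T: "random_field M T" and T': "random_field M T'"
    and eq: "\<And>x. x \<in> sphere2 \<Longrightarrow> AE \<omega> in M. T' \<omega> x = T \<omega> x"
  shows "modification M T T'"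
proof -
  interpret prob_space M by fact
  have "measure M {\<omega> \<in> space M. T' \<omega> x = T \<omega> x} = 1" if x: "x \<in> sphere2" for x
  proof -
    note [measurable] = jointly_measurable_section[OF T[unfolded random_field_def] x]
      jointly_measurable_section[OF T'[unfolded random_field_def] x]
    have "{\<omega> \<in> space M. T' \<omega> x = T \<omega> x} \<in> sets M" by measurable
    then show ?thesis using eq[OF x] by (simp add: prob_Collect_eq_1)
  qed
  then show ?thesis using T' by (simp add: modification_def)
qed

theorem theorem4p5:
  fixes M :: "'w measure"
    and T :: "'w \<Rightarrow> real^3 \<Rightarrow> real"
    and A :: "nat \<Rightarrow> real"
    and \<beta> :: real
  assumes "prob_space M"
    and "isotropic_gaussian_field M T"
    and "angular_power_spectrum M T A"
    and "0 < \<beta>" and "\<beta> \<le> 2"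
    and "summable (\<lambda>l. A l * real l powr (1 + \<beta>))"
  shows "\<exists>T'. modification M T T' \<and>
    (\<forall>\<omega>\<in>space M. geo_continuous (T' \<omega>) \<and>
       (\<forall>\<gamma>. 0 < \<gamma> \<and> \<gamma> < \<beta> / 2 \<longrightarrow> geo_hoelder_continuous \<gamma> (T' \<omega>)))"
proof -
  have T: "random_field M T" using assms(2) by (simp add: isotropic_gaussian_field_def)
  obtain T' where T': "(\<lambda>(\<omega>, x). T' \<omega> x) \<in> borel_measurable (M \<Otimes>\<^sub>M restrict_space borel sphere2)"
      "\<And>x. x \<in> sphere2 \<Longrightarrow> AE \<omega> in M. T' \<omega> x = T \<omega> x"
      "\<And>\<omega> \<gamma>. 0 < \<gamma> \<Longrightarrow> \<gamma> < \<beta> / 2 \<Longrightarrow>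
        \<exists>C. \<forall>x\<in>sphere2. \<forall>y\<in>sphere2. \<bar>T' \<omega> x - T' \<omega> y\<bar> \<le> C * dist x y powr \<gamma>"
    using kolmogorov_chentsov_all_moments[OF bounded_sphere T[unfolded random_field_def], of "\<beta> / 2"]
      increment_moment_bound[OF assms] assms(4) by auto
  have hoelder: "geo_hoelder_continuous \<gamma> (T' \<omega>)" if "0 < \<gamma>" "\<gamma> < \<beta> / 2" for \<gamma> \<omega>
    using T'(3)[OF that, of \<omega>] that(1) dist_hoelder_imp_geo_hoelder[of \<gamma> "T' \<omega>"] by fastforce
  have "geo_continuous (T' \<omega>)" for \<omega>
    using assms(4) by (intro geo_hoelder_imp_geo_continuous[of "\<beta> / 4"] hoelder) auto
  moreover have "modification M T T'"
    using T' by (intro AE_eq_imp_modification assms(1) T) (auto simp: random_field_def)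
  ultimately show ?thesis using hoelder by blast
qed

end
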